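(* Let $p$ be a prime and $\psi$ a nontrivial additive character of $\mathbb F_p$. Let $\mathbf a,\mathbf b\in\mathbb F_p^2$ ($\mathbf a$ a row vector, $\mathbf b$ a column vector) and let $A\in\operatorname{SL}(2,p)$ be diagonalisable with eigenvalues in $\mathbb F_p^*$. Assume that $\mathbf a,\mathbf aA$ are linearly independent over $\mathbb F_p$ and that $\mathbf b, A\mathbf b$ are linearly independent over $\mathbb F_p$. Let $\tau$ be the multiplicative order of $A$ and $$S_{2,p}(\mathbf a,\mathbf b;A)=\sum_{x=1}^{\tau}\psi\left(\mathbf aA^x\mathbf b\right).$$ Then $$S_{2,p}(\mathbf a,\mathbf b;A)\ll\min\left\{\tau^{23/36}p^{1/6},\ \tau^{20/27}p^{1/9}\right\},$$ with an absolute implied constant.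
   Context: $\operatorname{SL}(2,p)$ is the group of $2\times2$ matrices of determinant $1$ over $\mathbb F_p$. The multiplicative order of $A$ is the least $\tau\ge1$ with $A^\tau=I$. $U\ll V$ means $|U|\le cV$ for some constant $c>0$. *)

theory Defs
  imports "HOL-Analysis.Analysis" "HOL-Number_Theory.Residues"
begin

text \<open>
  The field of \<^term>\<open>p\<close> elements has to depend on a bound variable (the implied constant is
  quantified before the prime), so it is \<^term>\<open>residue_ring (int p)\<close> rather than a type, and the
  linear algebra below is relative to a HOL-Algebra ring \<open>R\<close>. Vectors and matrices are used
  only as containers of entries; the operations on them are those of \<open>R\<close>, not those of
  the entry type.
\<close>

definition vec2 :: "('a, 'm) ring_scheme \<Rightarrow> ('a^2) set" where
  "vec2 R = {v. \<forall>i. v $ i \<in> carrier R}"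

definition mat2 :: "('a, 'm) ring_scheme \<Rightarrow> ('a^2^2) set" where
  "mat2 R = {A. \<forall>i j. A $ i $ j \<in> carrier R}"

definition dot2 :: "('a, 'm) ring_scheme \<Rightarrow> 'a^2 \<Rightarrow> 'a^2 \<Rightarrow> 'a" where
  "dot2 R u v = u $ 1 \<otimes>\<^bsub>R\<^esub> v $ 1 \<oplus>\<^bsub>R\<^esub> u $ 2 \<otimes>\<^bsub>R\<^esub> v $ 2"

definition row_mult :: "('a, 'm) ring_scheme \<Rightarrow> 'a^2 \<Rightarrow> 'a^2^2 \<Rightarrow> 'a^2" where
  "row_mult R u A = (\<chi> j. dot2 R u (\<chi> i. A $ i $ j))"

definition mult_col :: "('a, 'm) ring_scheme \<Rightarrow> 'a^2^2 \<Rightarrow> 'a^2 \<Rightarrow> 'a^2" where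
  "mult_col R A v = (\<chi> i. dot2 R (A $ i) v)"

definition mat2_mult :: "('a, 'm) ring_scheme \<Rightarrow> 'a^2^2 \<Rightarrow> 'a^2^2 \<Rightarrow> 'a^2^2" where
  "mat2_mult R A B = (\<chi> i. row_mult R (A $ i) B)"

definition diag2 :: "('a, 'm) ring_scheme \<Rightarrow> 'a \<Rightarrow> 'a \<Rightarrow> 'a^2^2" where
  "diag2 R l m = (\<chi> i j. if i \<noteq> j then \<zero>\<^bsub>R\<^esub> else if i = 1 then l else m)"

definition mat2_one :: "('a, 'm) ring_scheme \<Rightarrow> 'a^2^2" where
  "mat2_one R = diag2 R \<one>\<^bsub>R\<^esub> \<one>\<^bsub>R\<^esub>"

definition det2 :: "('a, 'm) ring_scheme \<Rightarrow> 'a^2^2 \<Rightarrow> 'a" where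
  "det2 R A = A $ 1 $ 1 \<otimes>\<^bsub>R\<^esub> A $ 2 $ 2 \<ominus>\<^bsub>R\<^esub> A $ 1 $ 2 \<otimes>\<^bsub>R\<^esub> A $ 2 $ 1"

definition SL2 :: "('a, 'm) ring_scheme \<Rightarrow> ('a^2^2) monoid" where
  "SL2 R = \<lparr>carrier = {A \<in> mat2 R. det2 R A = \<one>\<^bsub>R\<^esub>}, mult = mat2_mult R, one = mat2_one R\<rparr>"

definition mult_order :: "('a, 'm) monoid_scheme \<Rightarrow> 'a \<Rightarrow> nat" where
  "mult_order G g = (LEAST t. t \<ge> 1 \<and> g [^]\<^bsub>G\<^esub> t = \<one>\<^bsub>G\<^esub>)"

definition lin_indep2 :: "('a, 'm) ring_scheme \<Rightarrow> 'a^2 \<Rightarrow> 'a^2 \<Rightarrow> bool" where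
  "lin_indep2 R u v \<longleftrightarrow> (\<forall>s\<in>carrier R. \<forall>t\<in>carrier R.
     (\<forall>i. s \<otimes>\<^bsub>R\<^esub> u $ i \<oplus>\<^bsub>R\<^esub> t \<otimes>\<^bsub>R\<^esub> v $ i = \<zero>\<^bsub>R\<^esub>) \<longrightarrow> s = \<zero>\<^bsub>R\<^esub> \<and> t = \<zero>\<^bsub>R\<^esub>)"

text \<open>
  \<open>A\<close> is similar over \<open>R\<close> to the diagonal matrix of its eigenvalues \<open>l\<close>, \<open>m\<close> (possibly equal);
  the base change is \<open>P\<close> with inverse \<open>Q\<close>.
\<close>

definition diagonalisable2 :: "('a, 'm) ring_scheme \<Rightarrow> 'a^2^2 \<Rightarrow> 'a \<Rightarrow> 'a \<Rightarrow> bool" where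
  "diagonalisable2 R A l m \<longleftrightarrow> (\<exists>P\<in>mat2 R. \<exists>Q\<in>mat2 R.
     mat2_mult R P Q = mat2_one R \<and> mat2_mult R Q P = mat2_one R \<and>
     A = mat2_mult R (mat2_mult R P (diag2 R l m)) Q)"

text \<open>Only the values of a character on the carrier matter.\<close>

definition additive_character :: "('a, 'm) ring_scheme \<Rightarrow> ('a \<Rightarrow> complex) \<Rightarrow> bool" where
  "additive_character R \<psi> \<longleftrightarrow> (\<forall>x\<in>carrier R. norm (\<psi> x) = 1) \<and>
     (\<forall>x\<in>carrier R. \<forall>y\<in>carrier R. \<psi> (x \<oplus>\<^bsub>R\<^esub> y) = \<psi> x * \<psi> y)"

definition nontrivial_character :: "('a, 'm) ring_scheme \<Rightarrow> ('a \<Rightarrow> complex) \<Rightarrow> bool" where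
  "nontrivial_character R \<psi> \<longleftrightarrow> additive_character R \<psi> \<and> (\<exists>x\<in>carrier R. \<psi> x \<noteq> 1)"

definition expsum2 ::
    "('a, 'm) ring_scheme \<Rightarrow> ('a \<Rightarrow> complex) \<Rightarrow> 'a^2 \<Rightarrow> 'a^2 \<Rightarrow> 'a^2^2 \<Rightarrow> complex" where
  "expsum2 R \<psi> a b A =
     (\<Sum>x = 1..mult_order (SL2 R) A. \<psi> (dot2 R (row_mult R a (A [^]\<^bsub>SL2 R\<^esub> x)) b))"

lemma (in cring) group_SL2: "group (SL2 R)"
proof (rule groupI)
  show "\<one>\<^bsub>SL2 R\<^esub> \<in> carrier (SL2 R)"
    by (simp add: SL2_def mat2_one_def diag2_def mat2_def det2_def a_minus_def)
  fix A assume A: "A \<in> carrier (SL2 R)"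
  then have cA: "A $ i $ j \<in> carrier R" for i j by (simp add: SL2_def mat2_def)
  show "\<one>\<^bsub>SL2 R\<^esub> \<otimes>\<^bsub>SL2 R\<^esub> A = A"
    using cA by (simp add: SL2_def mat2_one_def diag2_def mat2_mult_def row_mult_def dot2_def
        vec_eq_iff forall_2)
  have dA: "A $ 1 $ 1 \<otimes> A $ 2 $ 2 \<ominus> A $ 1 $ 2 \<otimes> A $ 2 $ 1 = \<one>"
    using A by (simp add: SL2_def det2_def)
  define B where "B = (\<chi> i j. if i = j then (if i = 1 then A $ 2 $ 2 else A $ 1 $ 1)
     else \<ominus> (A $ i $ j))"
  have "B \<in> carrier (SL2 R)"
    using cA dA by (simp add: SL2_def B_def mat2_def det2_def) (algebra)
  moreover have "B \<otimes>\<^bsub>SL2 R\<^esub> A = \<one>\<^bsub>SL2 R\<^esub>"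
    using cA dA by (simp add: SL2_def mat2_one_def diag2_def mat2_mult_def row_mult_def dot2_def
        vec_eq_iff forall_2 B_def) (algebra)
  ultimately show "\<exists>B\<in>carrier (SL2 R). B \<otimes>\<^bsub>SL2 R\<^esub> A = \<one>\<^bsub>SL2 R\<^esub>" by blast
  fix B assume B: "B \<in> carrier (SL2 R)"
  then have cB: "B $ i $ j \<in> carrier R" for i j by (simp add: SL2_def mat2_def)
  have dB: "B $ 1 $ 1 \<otimes> B $ 2 $ 2 \<ominus> B $ 1 $ 2 \<otimes> B $ 2 $ 1 = \<one>"
    using B by (simp add: SL2_def det2_def)
  have "det2 R (mat2_mult R A B) = det2 R A \<otimes> det2 R B"
    unfolding det2_def mat2_mult_def row_mult_def dot2_def using cA cB by simp algebra
  then show "A \<otimes>\<^bsub>SL2 R\<^esub> B \<in> carrier (SL2 R)"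
    using A B cA cB by (simp add: SL2_def mat2_def mat2_mult_def row_mult_def dot2_def)
  fix C assume C: "C \<in> carrier (SL2 R)"
  then have cC: "C $ i $ j \<in> carrier R" for i j by (simp add: SL2_def mat2_def)
  show "A \<otimes>\<^bsub>SL2 R\<^esub> B \<otimes>\<^bsub>SL2 R\<^esub> C = A \<otimes>\<^bsub>SL2 R\<^esub> (B \<otimes>\<^bsub>SL2 R\<^esub> C)"
    using cA cB cC by (simp add: SL2_def mat2_mult_def row_mult_def dot2_def vec_eq_iff
        l_distr r_distr m_assoc a_ac)
qed

end

theory Submission
  imports Defs "HOL-Computational_Algebra.Polynomial"
begin

text \<open>
  In an eigenbasis of \<open>A\<close> the exponent becomes \<open>u h + v / h\<close> with \<open>u\<close>, \<open>v\<close> nonzero and \<open>h\<close> running through the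
  group \<open>H\<close> of \<open>\<tau>\<close>-th roots of unity modulo \<open>p\<close>, so the sum \<open>S\<close> is a Kloosterman sum over \<open>H\<close>. Let \<open>Q\<^sub>k\<close> be the number of
  solutions in \<open>H\<close> of \<open>h\<^sub>1 + \<dots> + h\<^sub>k = g\<^sub>1 + \<dots> + g\<^sub>k\<close> for which the inverses satisfy the same equation.
  Invariance under \<open>(u, v) \<mapsto> (u g, v / g)\<close> for \<open>g \<in> H\<close>, Hoelder's inequality and orthogonality give
  \<open>(\<tau> |S|^k)^(2 l) \<le> \<tau>^(2 k (l - 1)) Q\<^sub>k Q\<^sub>l p^2\<close>. Here \<open>Q\<^sub>2 \<le> 3 \<tau>^2\<close> is elementary, and \<open>Q\<^sub>3 \<le> 40 \<tau>^(11/3)\<close> holds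
  for \<open>\<tau>^4 \<le> p^3\<close>: fixing \<open>h\<^sub>1 / g\<^sub>1\<close> and \<open>h\<^sub>2 h\<^sub>3 / (g\<^sub>2 g\<^sub>3)\<close> reduces it to bounding by \<open>13 \<tau>^(2/3)\<close> the number of \<open>x \<in> H\<close>
  whose image under a nondegenerate Moebius map lies in \<open>H\<close>, which is done by Stepanov's method.
  The pairs \<open>(k, l) = (3, 2)\<close> and \<open>(3, 3)\<close> give the two bounds; for \<open>\<tau>^4 > p^3\<close> the pair \<open>(2, 2)\<close> suffices.
\<close>

text \<open>The threshold \<open>\<tau>^4 \<le> P^3\<close> comes from Stepanov's method. The pieces
  of the auxiliary polynomial have degree just below \<open>\<tau> * B\<close> with \<open>B\<close>
  near \<open>\<tau>^(1/3)\<close>, and differentiation separates their monomials modulo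
  \<open>P\<close> only when that degree is below \<open>P\<close>. Past the threshold
  \<open>P\<close> is at most \<open>\<tau>^(4/3)\<close>, and then the bound from the pair (2, 2)
  is already stronger than both claims. The exponent 11/3 is 1 + 2 + 2/3: a free scaling, two
  ratios, and the Stepanov count. Stepanov's bound says nothing about ratios for which the Moebius
  map degenerates, and these need a separate count; they must not contribute more than order
  \<open>\<tau>^2\<close> points per scaling. Determinant 1 makes the second eigenvalue inverse to
  the first, which brings in the term \<open>v / h\<close>. The independence assumptions guarantee
  that \<open>a\<close> and \<open>b\<close> have no zero coordinate in the eigenbasis, hence that
  \<open>u\<close> and \<open>v\<close> are nonzero. The final constant is 2 because the numerical
  factors 9, 120 and 1600 lie below \<open>2^8\<close>, \<open>2^12\<close> and \<open>2^18\<close>,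
  and the norm is estimated through its 8th, 12th and 18th powers.\<close>

hide_const (open) Module.smult UnivPoly.coeff UnivPoly.monom

section \<open>Vanishing orders of integer polynomials modulo a prime\<close>

text \<open>Divisibility in \<open>F\<^sub>p[x]\<close>, expressed over the integers since \<open>p\<close> is a variable and not a type.\<close>

definition dvd_modulo :: "int \<Rightarrow> int poly \<Rightarrow> int poly \<Rightarrow> bool" where
  "dvd_modulo P u f \<longleftrightarrow> (\<exists>g h. f = u * g + smult P h)"

lemma dvd_moduloI: "f = u * g + smult P h \<Longrightarrow> dvd_modulo P u f"
  unfolding dvd_modulo_def by blast

lemma dvd_modulo_add:
  assumes "dvd_modulo P u f" "dvd_modulo P u g"
  shows "dvd_modulo P u (f + g)"
proof -
  obtain a b c d where "f = u * a + smult P b" "g = u * c + smult P d"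
    using assms unfolding dvd_modulo_def by blast
  then show ?thesis
    by (intro dvd_moduloI[of _ _ "a + c" _ "b + d"]) (simp add: algebra_simps smult_add_right)
qed

lemma dvd_modulo_mult:
  assumes "dvd_modulo P u f"
  shows "dvd_modulo P u (g * f)"
proof -
  obtain a b where "f = u * a + smult P b" using assms unfolding dvd_modulo_def by blast
  then show ?thesis
    by (intro dvd_moduloI[of _ _ "g * a" _ "g * b"]) (simp add: algebra_simps)
qed

lemma dvd_modulo_smult: "dvd_modulo P u f \<Longrightarrow> dvd_modulo P u (smult c f)"
  using dvd_modulo_mult[of P u f "[:c:]"] by simp

lemma dvd_modulo_diff:
  assumes "dvd_modulo P u f" "dvd_modulo P u g"
  shows "dvd_modulo P u (f - g)"
  using dvd_modulo_add[OF assms(1) dvd_modulo_smult[OF assms(2), of "-1"]] by simp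

lemma dvd_modulo_trans:
  assumes "u dvd v" "dvd_modulo P v f" shows "dvd_modulo P u f"
  using assms unfolding dvd_modulo_def dvd_def by (metis mult.assoc)

lemma dvd_imp_dvd_modulo: "u dvd f \<Longrightarrow> dvd_modulo P u f"
  unfolding dvd_modulo_def dvd_def by (metis add.right_neutral smult_0_right)

lemma dvd_modulo_const: "[:P:] dvd f \<Longrightarrow> dvd_modulo P u f"
proof -
  assume "[:P:] dvd f"
  then obtain h where "f = smult P h" by (elim dvdE) simp
  then show ?thesis by (intro dvd_moduloI[of _ _ 0 _ h]) simp
qed

lemma const_dvd_smult: "[:P:] dvd smult P h" for P :: int
  by (rule dvdI[of _ _ h]) simp

lemma dvd_modulo_poly_eq_0:
  assumes "dvd_modulo P u f" "P dvd poly u y"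
  shows "P dvd poly f y"
  using assms unfolding dvd_modulo_def by auto

lemma pderiv_power_mult_add:
  fixes u :: "int poly"
  shows "pderiv (u ^ Suc n * g + smult P h) =
    u ^ Suc n * pderiv g + smult (int (Suc n)) (u ^ n * pderiv u * g) + smult P (pderiv h)"
  by (simp only: pderiv_add pderiv_mult pderiv_smult pderiv_power_Suc) (simp add: algebra_simps)

lemma dvd_modulo_pderiv:
  assumes "dvd_modulo P (u ^ Suc n) f"
  shows "dvd_modulo P (u ^ n) (pderiv f)"
proof -
  obtain g h where "f = u ^ Suc n * g + smult P h"
    using assms unfolding dvd_modulo_def by blast
  then show ?thesis
    by (intro dvd_moduloI[of _ _ "smult (int (Suc n)) (pderiv u * g) + u * pderiv g" _ "pderiv h"])
      (simp only: pderiv_power_mult_add, simp add: algebra_simps)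
qed

text \<open>The operator \<open>f \<mapsto> x f' - n f\<close> kills the monomial \<open>x^n\<close> and loses one order of vanishing.\<close>

lemma sparse_poly_mod_prime:
  fixes P :: int and u f :: "int poly"
  assumes P: "prime P" and u: "P dvd poly u y" and y: "\<not> P dvd y"
  shows "int (degree f) < P \<Longrightarrow> card {n. \<not> P dvd coeff f n} \<le> R
     \<Longrightarrow> dvd_modulo P (u ^ R) f \<Longrightarrow> [:P:] dvd f"
proof (induction R arbitrary: f)
  case 0
  have "finite {n. \<not> P dvd coeff f n}"
    by (rule finite_subset[of _ "{..degree f}"]) (auto simp: coeff_eq_0 intro: ccontr leI)
  then show ?case using 0 by (auto simp: const_poly_dvd_iff)
next
  case (Suc R)
  have fin: "finite {n. \<not> P dvd coeff f n}"
    by (rule finite_subset[of _ "{..degree f}"]) (auto simp: coeff_eq_0 intro: ccontr leI)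
  show ?case
  proof (rule ccontr)
    assume "\<not> [:P:] dvd f"
    then obtain n where n: "\<not> P dvd coeff f n" by (auto simp: const_poly_dvd_iff)
    then have nd: "n \<le> degree f" by (metis coeff_eq_0 dvd_0_right linorder_not_le)
    define g where "g = [:0, 1:] * pderiv f - smult (int n) f"
    have cg: "coeff g m = (int m - int n) * coeff f m" for m
      by (cases m) (auto simp: g_def coeff_pderiv algebra_simps)
    have "{m. \<not> P dvd coeff g m} \<subseteq> {m. \<not> P dvd coeff f m} - {n}"
      by (auto simp: cg)
    then have "card {m. \<not> P dvd coeff g m} \<le> card ({m. \<not> P dvd coeff f m} - {n})"
      using fin by (intro card_mono) auto
    also have "\<dots> \<le> R" using Suc.prems(2) n fin by (simp add: card_Diff_singleton)
    finally have cR: "card {m. \<not> P dvd coeff g m} \<le> R" .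
    have "degree g \<le> degree f"
      by (rule degree_le) (auto simp: cg coeff_eq_0)
    then have dg: "int (degree g) < P" using Suc.prems(1) by linarith
    have "dvd_modulo P (u ^ R) g" unfolding g_def
      by (intro dvd_modulo_diff dvd_modulo_mult dvd_modulo_smult dvd_modulo_pderiv Suc.prems)
        (rule dvd_modulo_trans[OF _ Suc.prems(3)], simp)
    then have "[:P:] dvd g" using Suc.IH dg cR by blast
    then have Pg: "P dvd (int m - int n) * coeff f m" for m
      by (auto simp: const_poly_dvd_iff cg)
    have Pf: "P dvd coeff f m" if "m \<noteq> n" for m
    proof (cases "m \<le> degree f")
      case True
      \<comment> \<open>Both exponents are at most \<open>degree f < P\<close>, so distinct ones
        stay distinct modulo \<open>P\<close>, and the operator kills no monomial other than the one
        of degree \<open>n\<close>.\<close>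
      have "\<not> P dvd (int m - int n)"
      proof
        assume "P dvd (int m - int n)"
        then have "\<bar>P\<bar> \<le> \<bar>int m - int n\<bar>" using that by (intro dvd_imp_le_int) auto
        then show False using Suc.prems(1) True nd by linarith
      qed
      then show ?thesis using Pg[of m] P prime_dvd_mult_iff by blast
    qed (simp add: coeff_eq_0)
    \<comment> \<open>Only the monomial of degree \<open>n\<close> survives modulo \<open>P\<close>,
      and it cannot vanish at \<open>y\<close>, which is nonzero modulo \<open>P\<close>.\<close>
    have "P dvd poly f y" using dvd_modulo_poly_eq_0[OF Suc.prems(3)] u by simp
    moreover have "poly f y = (\<Sum>i\<in>{..degree f} - {n}. coeff f i * y ^ i) + coeff f n * y ^ n"
      using nd by (simp add: poly_altdef sum.remove[of "{..degree f}" n])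
    moreover have "P dvd (\<Sum>i\<in>{..degree f} - {n}. coeff f i * y ^ i)"
      by (rule dvd_sum) (simp add: Pf)
    ultimately have "P dvd coeff f n * y ^ n" by (simp add: dvd_add_right_iff)
    then show False using n y P by (auto simp: prime_dvd_mult_iff dest: prime_dvd_power)
  qed
qed

section \<open>Cancellation and coprime factors modulo a prime\<close>

lemma prime_dvd_poly_mult_iff:
  fixes P :: int
  assumes "prime P"
  shows "[:P:] dvd f * g \<longleftrightarrow> [:P:] dvd f \<or> [:P:] dvd g"
  using assms by (intro prime_elem_dvd_mult_iff) (auto intro: lift_prime_elem_poly)

lemma not_const_dvd_linear_power:
  fixes P :: int
  assumes "prime P" "\<not> P dvd a"
  shows "\<not> [:P:] dvd [:b, a:] ^ n"
proof (induction n)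
  case 0
  then show ?case using assms not_prime_unit by (auto simp: const_poly_dvd_iff dest: spec[of _ 0])
next
  case (Suc n)
  have "\<not> [:P:] dvd [:b, a:]"
    using assms(2) by (auto simp: const_poly_dvd_iff intro!: exI[of _ 1])
  then show ?case using Suc assms(1) by (simp only: power_Suc prime_dvd_poly_mult_iff) simp
qed

lemma dvd_modulo_cancel:
  fixes P :: int
  assumes P: "prime P" and w: "\<not> [:P:] dvd w" and "dvd_modulo P (w * u) (w * f)"
  shows "dvd_modulo P u f"
proof -
  obtain g h where "w * f = w * u * g + smult P h"
    using assms unfolding dvd_modulo_def by blast
  then have "[:P:] dvd w * (f - u * g)" by (intro dvdI[of _ _ h]) (simp add: algebra_simps)
  then have "[:P:] dvd f - u * g" using w P prime_dvd_poly_mult_iff by blast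
  then obtain k where "f - u * g = smult P k" by (elim dvdE) simp
  then show ?thesis by (intro dvd_moduloI[of _ _ g _ k]) (simp add: algebra_simps)
qed

lemma dvd_modulo_cancel_const:
  fixes P :: int
  assumes P: "prime P" and e: "\<not> P dvd e" and "dvd_modulo P u (smult e f)"
  shows "dvd_modulo P u f"
proof -
  have "coprime P e" using P e prime_imp_coprime by blast
  then obtain x y where "x * P + y * e = 1" using cong_solve_coprime_int
    by (metis bezout_int coprime_iff_gcd_eq_1)
  then have "f = smult y (smult e f) + smult P (smult x f)"
    by (metis add.commute mult.commute smult_1_left smult_add_left smult_smult)
  also have "dvd_modulo P u \<dots>"
    by (intro dvd_modulo_add dvd_modulo_smult assms dvd_modulo_const const_dvd_smult)
  finally show ?thesis .
qed

text \<open>The Bezout identity splits \<open>e f\<close> into a multiple of \<open>u f\<close> and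
  a multiple of \<open>v f\<close>. If \<open>u ^ j\<close> divides \<open>f\<close> modulo
  \<open>P\<close> and \<open>j < n\<close>, then \<open>u ^ Suc j\<close> divides both parts, so
  \<open>f\<close> gains one power of \<open>u\<close> per step. A constant \<open>e\<close> that is
  a unit modulo \<open>P\<close> stands in for 1 and keeps the cofactors integral.\<close>

lemma dvd_modulo_power_coprime:
  fixes P :: int
  assumes P: "prime P" and st: "s * u + t * v = [:e:]" and e: "\<not> P dvd e"
    and "dvd_modulo P (u ^ n) (v * f)"
  shows "dvd_modulo P (u ^ n) f"
proof -
  have "dvd_modulo P (u ^ j) f" if "j \<le> n" for j using that
  proof (induction j)
    case 0 then show ?case by (simp add: dvd_imp_dvd_modulo)
  next
    case (Suc j)
    have 1: "dvd_modulo P (u ^ Suc j) (t * (v * f))"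
      using Suc.prems by (intro dvd_modulo_mult dvd_modulo_trans[OF le_imp_power_dvd assms(4)])
    obtain g h where "f = u ^ j * g + smult P h"
      using Suc unfolding dvd_modulo_def by auto
    then have 2: "dvd_modulo P (u ^ Suc j) (s * (u * f))"
      by (intro dvd_modulo_mult dvd_moduloI[of _ _ g _ "u * h"]) (simp add: algebra_simps)
    have "s * (u * f) + t * (v * f) = smult e f"
      using arg_cong[OF st, of "\<lambda>w. w * f"] by (simp add: algebra_simps)
    then show ?case using dvd_modulo_add[OF 2 1] dvd_modulo_cancel_const[OF P e] by metis
  qed
  then show ?thesis by blast
qed

lemma dvd_modulo_power_coprime_power:
  fixes P :: int
  assumes P: "prime P" and st: "s * u + t * v = [:e:]" and e: "\<not> P dvd e"
    and "dvd_modulo P (u ^ n) (v ^ m * f)"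
  shows "dvd_modulo P (u ^ n) f"
  using assms(4)
proof (induction m)
  case (Suc m)
  then show ?case using dvd_modulo_power_coprime[OF P st e, of n "v ^ m * f"] by (simp add: mult.assoc)
qed simp

section \<open>Counting zeros with multiplicity modulo a prime\<close>

lemma degree_le_of_dvd_modulo:
  fixes P :: int
  assumes M: "lead_coeff M = 1" and f: "\<not> [:P:] dvd f" and "dvd_modulo P M f"
  shows "degree M \<le> degree f"
proof (rule ccontr)
  assume nle: "\<not> degree M \<le> degree f"
  obtain g h where gh: "f = M * g + smult P h"
    using assms unfolding dvd_modulo_def by blast
  have M0: "M \<noteq> 0" using M by auto
  \<comment> \<open>The witness \<open>h\<close> may have large degree. Reducing it modulo the monic
    \<open>M\<close> leaves a remainder \<open>r\<close>, and then degrees decide: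
    \<open>f - smult P r\<close> is a multiple of \<open>M\<close> of smaller degree, hence
    zero.\<close>
  obtain q r where qr: "pseudo_divmod h M = (q, r)" by fastforce
  from pseudo_divmod[OF M0 qr] M have h: "h = M * q + r" and r: "r = 0 \<or> degree r < degree M" by auto
  have eq: "f - smult P r = M * (g + smult P q)" using gh h by (simp add: algebra_simps smult_add_right)
  have "g + smult P q = 0"
  proof (rule ccontr)
    assume ne: "g + smult P q \<noteq> 0"
    have "degree (f - smult P r) < degree M"
      using nle r by (intro degree_diff_less) auto
    moreover have "degree (f - smult P r) = degree M + degree (g + smult P q)"
      unfolding eq using ne M0 by (rule degree_mult_eq[rotated])
    ultimately show False by simp
  qed
  with eq have "f = smult P r" by simp
  then show False using f const_dvd_smult by blast
qed

text \<open>Linear factors at distinct residues are coprime modulo \<open>P\<close>, since they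
  differ by the unit \<open>y - z\<close>. Dividing out one factor therefore preserves the orders of
  vanishing at the other points.\<close>

lemma prod_dvd_modulo:
  fixes P :: int
  assumes P: "prime P" and X: "finite X" "\<And>x y. x \<in> X \<Longrightarrow> y \<in> X \<Longrightarrow> P dvd x - y \<Longrightarrow> x = y"
    and "\<And>y. y \<in> X \<Longrightarrow> dvd_modulo P ([:-y, 1:] ^ K) f"
  shows "dvd_modulo P (\<Prod>y\<in>X. [:-y, 1:] ^ K) f"
  using X assms(4)
proof (induction X arbitrary: f)
  case empty then show ?case by (simp add: dvd_imp_dvd_modulo)
next
  case (insert z X)
  obtain g h where gh: "f = [:-z, 1:] ^ K * g + smult P h"
    using insert.prems(2)[of z] unfolding dvd_modulo_def by blast
  have "dvd_modulo P ([:-y, 1:] ^ K) g" if y: "y \<in> X" for y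
  proof (rule dvd_modulo_power_coprime_power[OF P])
    show "[:-1:] * [:-y, 1:] + [:1:] * [:-z, 1:] = [:y - z:]" by simp
    show "\<not> P dvd y - z" using insert y by auto
    have "[:-z, 1:] ^ K * g = f - smult P h" using gh by simp
    also have "dvd_modulo P ([:-y, 1:] ^ K) \<dots>"
      using y by (intro dvd_modulo_diff insert.prems dvd_modulo_const const_dvd_smult) auto
    finally show "dvd_modulo P ([:-y, 1:] ^ K) ([:-z, 1:] ^ K * g)" .
  qed
  then have "dvd_modulo P (\<Prod>y\<in>X. [:-y, 1:] ^ K) g" using insert by auto
  then obtain a b where "g = (\<Prod>y\<in>X. [:-y, 1:] ^ K) * a + smult P b"
    unfolding dvd_modulo_def by blast
  then show ?case using insert gh
    by (intro dvd_moduloI[of _ _ a _ "[:-z, 1:] ^ K * b + h"])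
      (simp add: algebra_simps smult_add_right)
qed

lemma multiplicity_count_mod_prime:
  fixes P :: int
  assumes P: "prime P" and X: "finite X" "\<And>x y. x \<in> X \<Longrightarrow> y \<in> X \<Longrightarrow> P dvd x - y \<Longrightarrow> x = y"
    and f: "\<not> [:P:] dvd f" and v: "\<And>y. y \<in> X \<Longrightarrow> dvd_modulo P ([:-y, 1:] ^ K) f"
  shows "K * card X \<le> degree f"
proof -
  have "degree (\<Prod>y\<in>X. [:-y, 1:] ^ K) \<le> degree f"
    using prod_dvd_modulo[OF P X v] f
    by (intro degree_le_of_dvd_modulo) (auto simp: lead_coeff_prod lead_coeff_power)
  then show ?thesis by (simp add: degree_prod_eq_sum_degree degree_linear_power mult.commute)
qed

text \<open>Where \<open>w\<close> does not vanish, \<open>w d/dx\<close> lowers the order of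
  vanishing by exactly one as long as that order is nonzero modulo \<open>P\<close>; hence the limit
  \<open>int K \<le> P\<close>. In the induction both \<open>f\<close> and its image vanish to order
  \<open>K\<close>, which forces the cofactor of \<open>?u ^ K\<close> in \<open>f\<close> to vanish
  at \<open>y\<close>.\<close>

lemma dvd_modulo_of_iterated_derivation:
  fixes P :: int and w :: "int poly"
  assumes P: "prime P" and w: "\<not> P dvd poly w y"
  shows "int K \<le> P \<Longrightarrow> (\<And>k. k < K \<Longrightarrow> P dvd poly (((\<lambda>g. w * pderiv g) ^^ k) f) y)
     \<Longrightarrow> dvd_modulo P ([:-y, 1:] ^ K) f"
proof (induction K arbitrary: f)
  case 0 then show ?case by (simp add: dvd_imp_dvd_modulo)
next
  case (Suc K)
  let ?u = "[:-y, 1:]" and ?D = "\<lambda>g. w * pderiv g"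
  have "dvd_modulo P (?u ^ K) f" using Suc by auto
  then obtain g h where gh: "f = ?u ^ K * g + smult P h" unfolding dvd_modulo_def by blast
  have D: "dvd_modulo P (?u ^ K) (?D f)"
  proof (rule Suc.IH)
    fix k assume "k < K"
    then show "P dvd poly ((?D ^^ k) (?D f)) y"
      using Suc.prems(2)[of "Suc k"] by (simp add: funpow_Suc_right del: funpow.simps)
  qed (use Suc in auto)
  have "P dvd poly g y"
  proof (cases K)
    case 0
    then show ?thesis using Suc.prems(2)[of 0] gh by (auto simp: dvd_add_left_iff)
  next
    case (Suc K')
    have "pderiv ?u = 1" by (simp add: pderiv_pCons)
    then have "w * (smult (int K) (?u ^ K' * g)) =
        ?D f - ?u ^ K * (w * pderiv g) - smult P (w * pderiv h)"
      unfolding gh Suc pderiv_power_mult_add by (simp only: algebra_simps mult_smult_right mult_1_right mult_1_left smult_add_right)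
    also have "dvd_modulo P (?u ^ K) \<dots>"
      by (intro dvd_modulo_diff D dvd_imp_dvd_modulo dvd_modulo_const const_dvd_smult) auto
    finally have "dvd_modulo P (?u ^ K' * ?u) (?u ^ K' * (w * (smult (int K) g)))"
      using Suc by (simp add: algebra_simps)
    then have "dvd_modulo P ?u (w * (smult (int K) g))"
      using dvd_modulo_cancel[OF P] not_const_dvd_linear_power[OF P] not_prime_unit P by metis
    then have "P dvd poly (w * (smult (int K) g)) y"
      by (rule dvd_modulo_poly_eq_0) simp
    then have "P dvd poly w y * (int K * poly g y)" by (simp add: mult.left_commute)
    moreover have "\<not> P dvd int K" using Suc Suc.prems(1)
      by (auto dest!: zdvd_imp_le)
    ultimately show ?thesis using P w by (auto simp: prime_dvd_mult_iff)
  qed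
  then obtain e where e: "poly g y = P * e" by (elim dvdE)
  have "poly (g - [:poly g y:]) y = 0" by simp
  then obtain g' where g': "g - [:poly g y:] = ?u * g'" unfolding poly_eq_0_iff_dvd by (elim dvdE)
  then have g: "g = ?u * g' + smult P [:e:]" using e by (simp add: algebra_simps)
  have "f = ?u ^ Suc K * g' + smult P (?u ^ K * [:e:] + h)"
    by (subst gh, subst g) (simp only: algebra_simps power_Suc mult_smult_left mult_smult_right smult_add_right)
  then show ?case by (rule dvd_moduloI)
qed

section \<open>Moebius transforms of roots of unity\<close>

text \<open>A homogeneous linear system with more unknowns than equations, solved by counting:
  \<open>P ^ card I\<close> vectors have at most \<open>P ^ card E\<close> images, so two vectors
  agree and their difference is a nontrivial solution.\<close>

lemma pigeonhole_mod:
  fixes P :: int and M :: "'e \<Rightarrow> 'i \<Rightarrow> int"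
  assumes P: "P > 1" and fin: "finite I" "finite E" and card: "card E < card I"
  obtains z where "\<exists>i\<in>I. \<not> P dvd z i" "\<And>e. e \<in> E \<Longrightarrow> P dvd (\<Sum>i\<in>I. z i * M e i)"
proof -
  define S where "S = (\<Pi>\<^sub>E i\<in>I. {0..<P})"
  define \<phi> where "\<phi> z = (\<lambda>e\<in>E. (\<Sum>i\<in>I. z i * M e i) mod P)" for z
  have "\<phi> ` S \<subseteq> (\<Pi>\<^sub>E e\<in>E. {0..<P})" using P by (auto simp: \<phi>_def)
  then have "card (\<phi> ` S) \<le> card (\<Pi>\<^sub>E e\<in>E. {0..<P})"
    using fin by (intro card_mono finite_PiE) auto
  also have "\<dots> = nat P ^ card E" using fin P by (simp add: card_PiE)
  also have "\<dots> < nat P ^ card I" using card P by (intro power_strict_increasing) auto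
  also have "\<dots> = card S" using fin P by (simp add: S_def card_PiE)
  finally have "\<not> inj_on \<phi> S" by (rule pigeonhole)
  then obtain z z' where z: "z \<in> S" "z' \<in> S" "z \<noteq> z'" "\<phi> z = \<phi> z'"
    unfolding inj_on_def by blast
  then obtain i where i: "i \<in> I" "z i \<noteq> z' i"
    unfolding S_def by (metis PiE_ext)
  have r: "z i \<in> {0..<P}" "z' i \<in> {0..<P}" using z i by (auto simp: S_def PiE_def Pi_def)
  have "\<not> P dvd z i - z' i"
  proof
    assume "P dvd z i - z' i"
    then have "\<bar>P\<bar> \<le> \<bar>z i - z' i\<bar>" using i by (intro dvd_imp_le_int) auto
    then show False using r by auto
  qed
  moreover have "P dvd (\<Sum>i\<in>I. (z i - z' i) * M e i)" if "e \<in> E" for e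
  proof -
    have "(\<Sum>i\<in>I. z i * M e i) mod P = (\<Sum>i\<in>I. z' i * M e i) mod P"
      using fun_cong[OF z(4), of e] that by (simp add: \<phi>_def)
    then show ?thesis by (simp add: mod_eq_dvd_iff left_diff_distrib sum_subtractf)
  qed
  ultimately show thesis using that[of "\<lambda>i. z i - z' i"] i by blast
qed

section \<open>Derivations of products of powers\<close>

lemma mult_pderiv_power: "u * pderiv (u ^ n) = smult (of_nat n) (u ^ n * pderiv u)"
  for u :: "int poly"
  by (cases n) (simp_all only: pderiv_power_Suc, simp_all add: algebra_simps)

lemma pderiv_sum_smult: "pderiv (\<Sum>i\<in>I. smult (z i) (f i)) = (\<Sum>i\<in>I. smult (z i) (pderiv (f i)))"
  by (induction I rule: infinite_finite_induct) (simp_all add: pderiv_add pderiv_smult)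

lemma funpow_derivation_sum:
  fixes w :: "int poly"
  shows "((\<lambda>g. w * pderiv g) ^^ k) (\<Sum>i\<in>I. smult (z i) (f i)) =
    (\<Sum>i\<in>I. smult (z i) (((\<lambda>g. w * pderiv g) ^^ k) (f i)))"
  by (induction k) (simp_all add: pderiv_sum_smult sum_distrib_left)

text \<open>The factor \<open>x * u * v\<close> clears the denominators of the logarithmic
  derivative of the product, so the powers reappear unchanged and only the cofactor \<open>q\<close>
  moves.\<close>

lemma derivation_prod_powers:
  fixes x u v q :: "int poly"
  assumes "pderiv x = smult s 1" "pderiv u = smult a 1" "pderiv v = smult c 1"
  shows "x * u * v * pderiv (q * (x ^ m * u ^ n * v ^ r)) =
    (x * u * v * pderiv q + q * (smult (int m * s) (u * v) + smult (int n * a) (x * v)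
      + smult (int r * c) (x * u))) * (x ^ m * u ^ n * v ^ r)"
proof -
  have "x * u * v * pderiv (q * (x ^ m * u ^ n * v ^ r)) =
    x * u * v * pderiv q * (x ^ m * u ^ n * v ^ r)
    + q * (u * v * (x * pderiv (x ^ m)) * u ^ n * v ^ r
         + x * v * x ^ m * (u * pderiv (u ^ n)) * v ^ r
         + x * u * x ^ m * u ^ n * (v * pderiv (v ^ r)))"
    unfolding pderiv_mult by (simp only: algebra_simps)
  then show ?thesis
    unfolding mult_pderiv_power assms
    by (simp only: mult_smult_left mult_smult_right algebra_simps smult_smult mult_1_right mult_1_left smult_add_right)
qed

text \<open>The derivation \<open>x (a x + b) (c x + d) d/dx\<close> multiplies each of the products
  \<open>x^m (a x + b)^n (c x + d)^r\<close> by a polynomial of degree at most 2.\<close>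

context
  fixes a b c d :: int
begin

definition "moebius_weight = [:0, 1:] * [:b, a:] * [:d, c:]"

text \<open>This is \<open>moebius_weight\<close> times the logarithmic derivative of
  \<open>moebius_prod m n r\<close>.\<close>

definition "moebius_log_deriv m n r = smult (int m) ([:b, a:] * [:d, c:])
  + smult (int n * a) ([:0, 1:] * [:d, c:]) + smult (int r * c) ([:0, 1:] * [:b, a:])"

definition "moebius_prod m n r = [:0, 1:] ^ m * [:b, a:] ^ n * [:d, c:] ^ r"

lemma derivation_moebius_prod:
  "moebius_weight * pderiv (q * moebius_prod m n r) =
    (moebius_weight * pderiv q + q * moebius_log_deriv m n r) * moebius_prod m n r"
  using derivation_prod_powers[of "[:0, 1:]" 1 "[:b, a:]" a "[:d, c:]" c q m n r]
  unfolding moebius_weight_def moebius_log_deriv_def moebius_prod_def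
  by (simp only: pderiv_pCons) simp

lemma degree_moebius_derivation:
  assumes "degree q \<le> N"
  shows "degree (moebius_weight * pderiv q + q * moebius_log_deriv m n r) \<le> N + 2"
proof (rule degree_add_le)
  have lin: "degree [:s, t:] \<le> 1" for s t :: int by simp
  have w: "degree moebius_weight \<le> 3"
    unfolding moebius_weight_def
    by (rule order_trans[OF degree_mult_le] order_trans[OF add_mono[OF degree_mult_le lin]])+ simp
  show "degree (moebius_weight * pderiv q) \<le> N + 2"
  proof (cases "degree q = 0")
    case True
    then show ?thesis by (metis degree_0 mult_zero_right pderiv_eq_0_iff zero_le)
  next
    case False
    have "degree (moebius_weight * pderiv q) \<le> 3 + (degree q - 1)"
      using degree_mult_le[of moebius_weight "pderiv q"] w by (simp add: degree_pderiv)
    then show ?thesis using False assms by simp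
  qed
  have "degree (moebius_log_deriv m n r) \<le> 2"
    unfolding moebius_log_deriv_def
    by (intro degree_add_le order_trans[OF degree_smult_le] order_trans[OF degree_mult_le]) auto
  then show "degree (q * moebius_log_deriv m n r) \<le> N + 2"
    using degree_mult_le[of q "moebius_log_deriv m n r"] assms by linarith
qed

primrec moebius_coeff where
  "moebius_coeff m n r q 0 = q"
| "moebius_coeff m n r q (Suc k) = moebius_weight * pderiv (moebius_coeff m n r q k)
     + moebius_coeff m n r q k * moebius_log_deriv m n r"

text \<open>The growth by 2 per step does not depend on the exponents \<open>m\<close>,
  \<open>n\<close>, \<open>r\<close>, which later are multiples of \<open>\<tau>\<close>; this is
  why vanishing to high order costs few linear conditions.\<close>

lemma degree_moebius_coeff: "degree (moebius_coeff m n r q k) \<le> degree q + 2 * k"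
proof (induction k)
  case (Suc k)
  then show ?case using degree_moebius_derivation[OF Suc] by simp
qed simp

lemma funpow_derivation_moebius_prod:
  "((\<lambda>g. moebius_weight * pderiv g) ^^ k) (q * moebius_prod m n r) =
    moebius_coeff m n r q k * moebius_prod m n r"
  by (induction k) (simp_all add: derivation_moebius_prod)

end

lemma degree_moebius_prod: "degree (moebius_prod a b c d m n r) \<le> m + n + r"
  unfolding moebius_prod_def
  by (intro order_trans[OF degree_mult_le] add_mono order_trans[OF degree_power_le]) auto

lemma poly_moebius_prod:
  "poly (moebius_prod a b c d m n r) y = y ^ m * (a * y + b) ^ n * (c * y + d) ^ r"
  by (simp add: moebius_prod_def poly_power algebra_simps)

text \<open>
  Stepanov's method. The auxiliary polynomial \<open>\<Psi>\<close> is a combination of the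
  \<open>x^(l + \<tau> i) (a x + b)^(\<tau> j) (c x + d)^(\<tau> (B - 1 - j))\<close> with \<open>i, j < B\<close> and \<open>l < A\<close>. On \<open>X\<close> the \<open>\<tau>\<close>-th powers cancel, so that
  vanishing there to order \<open>A\<close> amounts to fewer than \<open>A B^2\<close> linear conditions. To see that \<open>\<Psi>\<close> is nonzero
  modulo \<open>P\<close>, take the least \<open>j\<close> that occurs: its part would be a sparse polynomial divisible by \<open>(a x + b)^\<tau>\<close>.
\<close>

lemma moebius_roots_of_unity_bound:
  fixes P a b c d :: int and \<tau> A B :: nat
  assumes P: "prime P" and a: "\<not> P dvd a" and b: "\<not> P dvd b" and c: "\<not> P dvd c"
    and det: "\<not> P dvd a * d - b * c"
    and A: "A > 0" "2 * A \<le> B * B" "A * B \<le> \<tau>" and B: "int (\<tau> * B) \<le> P"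
    and X: "finite X" "\<And>x y. x \<in> X \<Longrightarrow> y \<in> X \<Longrightarrow> P dvd x - y \<Longrightarrow> x = y"
    and X1: "\<And>x. x \<in> X \<Longrightarrow> [x ^ \<tau> = 1] (mod P)"
    and X2: "\<And>x. x \<in> X \<Longrightarrow> [(a * x + b) ^ \<tau> = (c * x + d) ^ \<tau>] (mod P)"
  shows "A * card X \<le> A + 2 * (\<tau> * B)"
proof -
  let ?D = "\<lambda>g. moebius_weight a b c d * pderiv g"
  let ?base = "\<lambda>i j. moebius_prod a b c d (\<tau> * i) (\<tau> * j) (\<tau> * (B - 1 - j))"
  let ?coef = "\<lambda>k i j l. moebius_coeff a b c d (\<tau> * i) (\<tau> * j) (\<tau> * (B - 1 - j)) ([:0, 1:] ^ l) k"
  have B0: "B > 0" using A by (cases B) auto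
  have \<tau>0: "\<tau> > 0" using A B0 by (metis less_le_trans nat_0_less_mult_iff)
  have AB: "A \<le> A * B" using B0 by simp
  define I where "I = {..<B} \<times> {..<B} \<times> {..<A}"
  \<comment> \<open>For each \<open>k < A\<close> a polynomial of degree below
    \<open>A + 2 * k\<close> has to vanish identically, one equation per coefficient. This makes
    \<open>A * A + A * (A - 1) < 2 * A * A\<close> equations, and \<open>2 * A \<le> B * B\<close>
    keeps them below the \<open>A * B * B\<close> unknowns.\<close>
  define E where "E = (SIGMA k:{..<A}. {..<A + 2 * k})"
  have finI: "finite I" by (simp add: I_def)
  have sumE: "(\<Sum>k<n. A + 2 * k) = n * A + n * (n - 1)" for n
  proof (induction n)
    case (Suc n)
    then show ?case by (cases n) (auto simp: algebra_simps)
  qed simp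
  have "card E = A * A + A * (A - 1)" by (simp add: E_def sumE)
  also have "\<dots> < 2 * A * A" using A(1) by (cases A) (auto simp: algebra_simps)
  also have "\<dots> \<le> B * B * A" using A(2) by (intro mult_right_mono) auto
  also have "\<dots> = card I" by (simp add: I_def)
  finally have "card E < card I" .
  define M where "M e t = (case e of (k, n) \<Rightarrow> case t of (i, j, l) \<Rightarrow> coeff (?coef k i j l) n)" for e t
  obtain z where z: "\<exists>e\<in>I. \<not> P dvd z e" "\<And>e. e \<in> E \<Longrightarrow> P dvd (\<Sum>t\<in>I. z t * M e t)"
  proof (rule pigeonhole_mod[of P I E M])
    show "1 < P" using prime_gt_1_int[OF P] .
    show "finite E" by (simp add: E_def)
  qed (use finI \<open>card E < card I\<close> in auto)
  define \<Psi> where "\<Psi> = (\<Sum>t\<in>I. smult (z t) (case t of (i, j, l) \<Rightarrow> [:0, 1:] ^ l * ?base i j))"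
  have D\<Psi>: "(?D ^^ k) \<Psi> = (\<Sum>t\<in>I. smult (z t) (case t of (i, j, l) \<Rightarrow> ?coef k i j l * ?base i j))" for k
    unfolding \<Psi>_def funpow_derivation_sum
    by (intro sum.cong refl) (auto simp: funpow_derivation_moebius_prod)
  have no_common_zero: "\<not> (P dvd a * x + b \<and> P dvd c * x + d)" for x
  proof
    assume "P dvd a * x + b \<and> P dvd c * x + d"
    then have "P dvd a * (c * x + d) - c * (a * x + b)" by (intro dvd_diff dvd_mult) auto
    then show False using det by (simp add: algebra_simps)
  qed
  have mult: "dvd_modulo P ([:- y, 1:] ^ A) \<Psi>" if y: "y \<in> X" for y
  proof (rule dvd_modulo_of_iterated_derivation[OF P])
    have y1: "\<not> P dvd y"
    proof
      assume "P dvd y"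
      then have "P dvd y ^ \<tau>" using \<tau>0 by (meson dvd_power dvd_trans)
      then have "P dvd 1" using X1[OF y] by (simp add: cong_dvd_iff)
      then show False using P not_prime_unit by blast
    qed
    have "P dvd a * y + b \<longleftrightarrow> P dvd c * y + d"
      using X2[OF y] \<tau>0 P by (metis cong_dvd_iff prime_dvd_power_iff)
    then have y2: "\<not> P dvd a * y + b" "\<not> P dvd c * y + d" using no_common_zero by blast+
    moreover have "poly (moebius_weight a b c d) y = y * (a * y + b) * (c * y + d)"
      by (simp add: moebius_weight_def algebra_simps)
    ultimately show "\<not> P dvd poly (moebius_weight a b c d) y"
      using y1 P by (simp add: prime_dvd_mult_iff)
    have "\<tau> * 1 \<le> \<tau> * B" using B0 by (intro mult_left_mono) auto
    then have "A \<le> \<tau> * B" using A AB by linarith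
    then show "int A \<le> P" using B by linarith
    fix k assume k: "k < A"
    \<comment> \<open>All products \<open>?base i j\<close> take this value at \<open>y\<close>,
      because \<open>y ^ \<tau>\<close> is 1 and \<open>(a * y + b) ^ \<tau>\<close> may be
      exchanged for \<open>(c * y + d) ^ \<tau>\<close>. For this reason the exponents of the two
      linear forms were chosen with the constant sum \<open>\<tau> * (B - 1)\<close>.\<close>
    define C where "C = (c * y + d) ^ (\<tau> * (B - 1))"
    have base: "[poly (?base i j) y = C] (mod P)" if "j < B" for i j
    proof -
      have "[(y ^ \<tau>) ^ i * ((a * y + b) ^ \<tau>) ^ j * ((c * y + d) ^ \<tau>) ^ (B - 1 - j)
          = 1 ^ i * ((c * y + d) ^ \<tau>) ^ j * ((c * y + d) ^ \<tau>) ^ (B - 1 - j)] (mod P)"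
        by (intro cong_mult cong_pow X1 X2 y cong_refl)
      also have "1 ^ i * ((c * y + d) ^ \<tau>) ^ j * ((c * y + d) ^ \<tau>) ^ (B - 1 - j) = C"
        using that by (simp add: C_def power_mult flip: power_add)
      finally show ?thesis by (simp add: poly_moebius_prod power_mult)
    qed
    have "[poly ((?D ^^ k) \<Psi>) y = (\<Sum>t\<in>I. z t * (case t of (i, j, l) \<Rightarrow> poly (?coef k i j l) y * C))] (mod P)"
      unfolding D\<Psi> poly_sum
    proof (intro cong_sum)
      fix t assume "t \<in> I"
      then obtain i j l where "t = (i, j, l)" "j < B" by (auto simp: I_def)
      then show "[poly (smult (z t) (case t of (i, j, l) \<Rightarrow> ?coef k i j l * ?base i j)) y =
         z t * (case t of (i, j, l) \<Rightarrow> poly (?coef k i j l) y * C)] (mod P)"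
        using base[of j i] by (auto intro!: cong_mult)
    qed
    also have "(\<Sum>t\<in>I. z t * (case t of (i, j, l) \<Rightarrow> poly (?coef k i j l) y * C)) =
        (\<Sum>t\<in>I. \<Sum>n<A + 2 * k. z t * ((case t of (i, j, l) \<Rightarrow> coeff (?coef k i j l) n) * y ^ n * C))"
    proof (intro sum.cong refl)
      fix t assume "t \<in> I"
      then obtain i j l where t: "t = (i, j, l)" "l < A" by (auto simp: I_def)
      have "degree (?coef k i j l) \<le> l + 2 * k"
        using degree_moebius_coeff[of a b c d _ _ _ "[:0, 1:] ^ l" k] by (simp add: degree_linear_power[of 0, simplified])
      then have "degree (?coef k i j l) < A + 2 * k" using t by linarith
      then have "poly (?coef k i j l) y = (\<Sum>n<A + 2 * k. coeff (?coef k i j l) n * y ^ n)"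
        unfolding poly_altdef by (intro sum.mono_neutral_left) (auto simp: coeff_eq_0)
      then show "z t * (case t of (i, j, l) \<Rightarrow> poly (?coef k i j l) y * C) =
        (\<Sum>n<A + 2 * k. z t * ((case t of (i, j, l) \<Rightarrow> coeff (?coef k i j l) n) * y ^ n * C))"
        using t by (simp add: sum_distrib_left sum_distrib_right)
    qed
    also have "\<dots> = (\<Sum>n<A + 2 * k. y ^ n * C * (\<Sum>t\<in>I. z t * (case t of (i, j, l) \<Rightarrow> coeff (?coef k i j l) n)))"
      by (subst sum.swap) (simp add: sum_distrib_left mult_ac)
    finally have eq: "[poly ((?D ^^ k) \<Psi>) y = \<dots>] (mod P)" .
    have "P dvd (\<Sum>n<A + 2 * k. y ^ n * C * (\<Sum>t\<in>I. z t * (case t of (i, j, l) \<Rightarrow> coeff (?coef k i j l) n)))"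
    proof (rule dvd_sum, rule dvd_mult)
      fix n assume "n \<in> {..<A + 2 * k}"
      then show "P dvd (\<Sum>t\<in>I. z t * (case t of (i, j, l) \<Rightarrow> coeff (?coef k i j l) n))"
        using z(2)[of "(k, n)"] k by (simp add: E_def M_def)
    qed
    then show "P dvd poly ((?D ^^ k) \<Psi>) y" using cong_dvd_iff[OF eq] by blast
  qed
  define G where "G j = (\<Sum>i<B. \<Sum>l<A. monom (z (i, j, l)) (l + \<tau> * i))" for j
  have \<Psi>G: "\<Psi> = (\<Sum>j<B. [:b, a:] ^ (\<tau> * j) * [:d, c:] ^ (\<tau> * (B - 1 - j)) * G j)"
  proof -
    have "\<Psi> = (\<Sum>i<B. \<Sum>j<B. \<Sum>l<A. smult (z (i, j, l)) ([:0, 1:] ^ l * ?base i j))"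
      unfolding \<Psi>_def I_def sum.cartesian_product by (intro sum.cong refl) auto
    also have "\<dots> = (\<Sum>j<B. \<Sum>i<B. \<Sum>l<A. smult (z (i, j, l)) ([:0, 1:] ^ l * ?base i j))"
      by (rule sum.swap)
    also have "\<dots> = (\<Sum>j<B. [:b, a:] ^ (\<tau> * j) * [:d, c:] ^ (\<tau> * (B - 1 - j)) * G j)"
      unfolding G_def sum_distrib_left
      by (intro sum.cong refl)
        (simp only: moebius_prod_def monom_altdef power_add mult_smult_right mult_ac)
    finally show ?thesis .
  qed
  \<comment> \<open>Since \<open>l < A \<le> \<tau>\<close>, the exponent
    \<open>l + \<tau> * i\<close> determines \<open>i\<close> and \<open>l\<close>. The coefficients
    of \<open>G j\<close> are thus the unknowns themselves, without cancellation.\<close>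
  have coeffG: "coeff (G j) (l + \<tau> * i) = z (i, j, l)" if "i < B" "l < A" for i j l
  proof -
    have inj: "l' + \<tau> * i' = l + \<tau> * i \<longleftrightarrow> i' = i \<and> l' = l" if "l' < A" for i' l'
    proof
      assume eq: "l' + \<tau> * i' = l + \<tau> * i"
      have lt: "l' < \<tau>" "l < \<tau>" using that \<open>l < A\<close> A AB by linarith+
      have "(l' + \<tau> * i') mod \<tau> = (l + \<tau> * i) mod \<tau>" using eq by simp
      then have "l' = l" using lt by simp
      then show "i' = i \<and> l' = l" using eq \<tau>0 by simp
    qed auto
    have "coeff (G j) (l + \<tau> * i) = (\<Sum>i'<B. \<Sum>l'<A. if i' = i \<and> l' = l then z (i', j, l') else 0)"
      unfolding G_def coeff_sum by (intro sum.cong refl) (auto simp: inj)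
    also have "\<dots> = (\<Sum>i'<B. if i' = i then z (i', j, l) else 0)"
      using that by (intro sum.cong refl) (auto simp: sum.delta)
    also have "\<dots> = z (i, j, l)" using that by (simp add: sum.delta)
    finally show ?thesis .
  qed
  have coeffG0: "\<exists>i<B. \<exists>l<A. n = l + \<tau> * i" if "coeff (G j) n \<noteq> 0" for j n
  proof -
    have "coeff (G j) n = (\<Sum>i<B. \<Sum>l<A. if l + \<tau> * i = n then z (i, j, l) else 0)"
      by (simp add: G_def coeff_sum)
    moreover have "\<dots> = 0" if "\<not> (\<exists>i<B. \<exists>l<A. n = l + \<tau> * i)"
      using that by (intro sum.neutral ballI) auto
    ultimately show ?thesis using that by argo
  qed
  have \<Psi>0: "\<not> [:P:] dvd \<Psi>"
  proof
    assume \<Psi>: "[:P:] dvd \<Psi>"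
    \<comment> \<open>When the earlier pieces vanish modulo \<open>P\<close>, dividing by
      \<open>(a x + b)^(\<tau> j)\<close> leaves the later ones divisible by
      \<open>(a x + b)^\<tau>\<close>. The same then holds for \<open>G j\<close>, because the
      determinant makes \<open>c x + d\<close> coprime to \<open>a x + b\<close>.\<close>
    have G0: "j < B \<Longrightarrow> [:P:] dvd G j" for j
    proof (induction j rule: less_induct)
      case (less j)
      let ?u = "[:b, a:]" and ?v = "[:d, c:]"
      define g where "g j' = ?u ^ (\<tau> * j') * ?v ^ (\<tau> * (B - 1 - j')) * G j'" for j'
      define h where "h = (\<Sum>j'\<in>{j<..<B}. ?u ^ (\<tau> * (j' - j - 1)) * ?v ^ (\<tau> * (B - 1 - j')) * G j')"
      have split: "{..<B} = {..<j} \<union> {j} \<union> {j<..<B}" using less.prems by auto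
      have "\<Psi> = (\<Sum>j'<j. g j') + (g j + (\<Sum>j'\<in>{j<..<B}. g j'))"
        unfolding \<Psi>G g_def[symmetric] split
        by (subst sum.union_disjoint; (auto simp: add.assoc)?)+
      moreover have "[:P:] dvd (\<Sum>j'<j. g j')"
        unfolding g_def using less by (intro dvd_sum dvd_mult) auto
      ultimately have *: "[:P:] dvd g j + (\<Sum>j'\<in>{j<..<B}. g j')"
        using \<Psi> by (simp only: dvd_add_right_iff)
      have "(\<Sum>j'\<in>{j<..<B}. g j') = ?u ^ (\<tau> * j) * (?u ^ \<tau> * h)"
        unfolding sum_distrib_left h_def
      proof (intro sum.cong refl)
        fix j' assume "j' \<in> {j<..<B}"
        then obtain t where "j' = Suc (j + t)" by (auto simp: less_iff_Suc_add)
        then have "\<tau> * j' = \<tau> * j + \<tau> + \<tau> * (j' - j - 1)" by (simp add: algebra_simps)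
        then show "g j' = ?u ^ (\<tau> * j) * (?u ^ \<tau> * (?u ^ (\<tau> * (j' - j - 1)) * ?v ^ (\<tau> * (B - 1 - j')) * G j'))"
          by (simp only: g_def power_add mult_ac)
      qed
      then have "g j + (\<Sum>j'\<in>{j<..<B}. g j') = ?u ^ (\<tau> * j) * (?v ^ (\<tau> * (B - 1 - j)) * G j + ?u ^ \<tau> * h)"
        by (simp only: g_def distrib_left mult.assoc)
      then have "[:P:] dvd ?v ^ (\<tau> * (B - 1 - j)) * G j + ?u ^ \<tau> * h"
        using * not_const_dvd_linear_power[OF P a, of b "\<tau> * j"]
        by (simp only: prime_dvd_poly_mult_iff[OF P] simp_thms)
      then have "dvd_modulo P (?u ^ \<tau>) ((?v ^ (\<tau> * (B - 1 - j)) * G j + ?u ^ \<tau> * h) - ?u ^ \<tau> * h)"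
        by (intro dvd_modulo_diff dvd_modulo_const dvd_imp_dvd_modulo) auto
      then have "dvd_modulo P (?u ^ \<tau>) (?v ^ (\<tau> * (B - 1 - j)) * G j)" by simp
      moreover have "[:-c:] * ?u + [:a:] * ?v = [:a * d - b * c:]" by (simp add: algebra_simps)
      ultimately have "dvd_modulo P (?u ^ \<tau>) (G j)"
        using dvd_modulo_power_coprime_power[OF P] det by blast
      \<comment> \<open>The root \<open>- b / a\<close> is nonzero modulo \<open>P\<close> because
        \<open>b\<close> is, as the lemma on sparse polynomials demands.\<close>
      moreover have "\<exists>y. P dvd poly ?u y \<and> \<not> P dvd y"
      proof -
        have "coprime a P" using P a by (metis prime_imp_coprime coprime_commute)
        then obtain a' where a': "[a * a' = 1] (mod P)" using cong_solve_coprime_int by blast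
        have "[b + a * (- b * a') = b + (- b) * 1] (mod P)"
          using cong_add[OF cong_refl cong_mult[OF cong_refl a', of "-b"], of b] by (simp add: mult_ac)
        then have "P dvd poly ?u (- b * a')" by (simp add: cong_0_iff algebra_simps)
        moreover from this have "\<not> P dvd (- b * a')"
          using b by (metis (no_types, opaque_lifting) add.commute add_0_right dvd_add_left_iff dvd_mult dvd_mult2 mult.commute poly_0 poly_pCons)
        ultimately show ?thesis by blast
      qed
      then obtain y where y: "P dvd poly ?u y" "\<not> P dvd y" by blast
      moreover have "degree (G j) \<le> \<tau> * B - 1"
      proof (rule degree_le, intro allI impI, rule ccontr)
        fix n assume n: "\<tau> * B - 1 < n" "coeff (G j) n \<noteq> 0"
        then obtain i l where il: "i < B" "l < A" "n = l + \<tau> * i" using coeffG0 by blast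
        then have "l + \<tau> * i < \<tau> + \<tau> * i" using A AB by linarith
        also have "\<dots> = \<tau> * Suc i" by simp
        also have "\<dots> \<le> \<tau> * B" using il by (intro mult_left_mono) auto
        finally show False using n il by linarith
      qed
      then have "int (degree (G j)) < P" using B B0 \<tau>0
        by (smt (verit) Suc_pred' Suc_leI le_imp_less_Suc nat_0_less_mult_iff of_nat_less_iff)
      \<comment> \<open>There are at most \<open>A * B \<le> \<tau>\<close> monomials, no more than
        the order of vanishing just found.\<close>
      moreover have "card {n. \<not> P dvd coeff (G j) n} \<le> A * B"
      proof -
        have "{n. \<not> P dvd coeff (G j) n} \<subseteq> (\<lambda>(i, l). l + \<tau> * i) ` ({..<B} \<times> {..<A})"
          using coeffG0[of j] by force
        then have "card {n. \<not> P dvd coeff (G j) n} \<le> card ((\<lambda>(i, l). l + \<tau> * i) ` ({..<B} \<times> {..<A}))"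
          by (intro card_mono) auto
        also have "\<dots> \<le> B * A" using card_image_le[of "{..<B} \<times> {..<A}" "\<lambda>(i, l). l + \<tau> * i"] by simp
        finally show ?thesis by (simp add: mult.commute)
      qed
      ultimately show "[:P:] dvd G j"
        using sparse_poly_mod_prime[OF P y] A(3) le_trans by blast
    qed
    obtain i j l where ijl: "i < B" "j < B" "l < A" "\<not> P dvd z (i, j, l)"
      using z(1) by (auto simp: I_def)
    then show False using G0[of j] coeffG[of i l j] by (metis const_poly_dvd_iff)
  qed
  have "A * card X \<le> degree \<Psi>"
    using multiplicity_count_mod_prime[OF P X \<Psi>0 mult] .
  also have "degree \<Psi> \<le> A + 2 * (\<tau> * B)"
    unfolding \<Psi>_def
  proof (intro degree_sum_le finI order_trans[OF degree_smult_le], goal_cases)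
    case (1 t)
    then obtain i j l where t: "t = (i, j, l)" "i < B" "j < B" "l < A" by (auto simp: I_def)
    have "degree ([:0, 1:] ^ l * ?base i j) \<le> l + (\<tau> * i + \<tau> * j + \<tau> * (B - 1 - j))"
      using degree_mult_le[of "[:0, 1:] ^ l" "?base i j"]
        degree_moebius_prod[of a b c d "\<tau> * i" "\<tau> * j" "\<tau> * (B - 1 - j)"]
      by (simp add: degree_linear_power[of 0, simplified])
    also have "\<tau> * i + \<tau> * j + \<tau> * (B - 1 - j) = \<tau> * (i + (B - 1))"
      using t by (simp flip: distrib_left)
    also have "\<dots> \<le> \<tau> * (2 * B)" using t by (intro mult_left_mono) auto
    finally show ?case using t by (simp add: mult_ac)
  qed
  finally show ?thesis .
qed

text \<open>The bound \<open>1 + 2 * \<tau> * B / A\<close> calls for a large \<open>A\<close>: the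
  choice \<open>B * B div 2\<close> exhausts \<open>2 * A \<le> B * B\<close>, and
  \<open>A * B \<le> \<tau>\<close> then limits \<open>B\<close> to the order of
  \<open>\<tau>^(1/3)\<close>. For this \<open>B\<close> the condition
  \<open>\<tau> * B \<le> P\<close> follows from \<open>\<tau>^4 \<le> P^3\<close>, and the bound
  has order \<open>\<tau> / B\<close>.\<close>

lemma moebius_roots_of_unity_bound_powr:
  fixes P a b c d :: int and \<tau> :: nat
  assumes P: "prime P" and abc: "\<not> P dvd a" "\<not> P dvd b" "\<not> P dvd c" "\<not> P dvd a * d - b * c"
    and \<tau>: "\<tau> > 0" and \<tau>P: "int \<tau> ^ 4 \<le> P ^ 3"
    and X: "finite X" "\<And>x y. x \<in> X \<Longrightarrow> y \<in> X \<Longrightarrow> P dvd x - y \<Longrightarrow> x = y"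
    and X12: "\<And>x. x \<in> X \<Longrightarrow> [x ^ \<tau> = 1] (mod P)"
     "\<And>x. x \<in> X \<Longrightarrow> [(a * x + b) ^ \<tau> = (c * x + d) ^ \<tau>] (mod P)"
    and card: "card X \<le> \<tau>"
  shows "real (card X) \<le> 13 * \<tau> powr (2/3)"
proof -
  define t where "t = real \<tau> powr (1/3)"
  have t3: "t ^ 3 = \<tau>" using \<tau> by (simp add: t_def powr_power)
  have t2: "t ^ 2 = \<tau> powr (2/3)" using \<tau> by (simp add: t_def powr_power)
  have t1: "t \<ge> 1" using \<tau> by (simp add: t_def ge_one_powr_ge_zero)
  show ?thesis
  proof (cases "t < 2")
    \<comment> \<open>Here \<open>B\<close> would be 1 and \<open>A\<close> would be 0; the trivial
      bound by \<open>\<tau> = t ^ 3\<close> is good enough.\<close>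
    case True
    have "real (card X) \<le> t * t ^ 2" using card t3 by (simp add: power3_eq_cube power2_eq_square)
    also have "\<dots> \<le> 13 * t ^ 2" using True by (intro mult_right_mono) auto
    finally show ?thesis by (simp add: t2)
  next
    case False
    define B where "B = nat \<lfloor>t\<rfloor>"
    define A where "A = B * B div 2"
    have B: "real B \<le> t" "t < real B + 1" using t1 unfolding B_def by linarith+
    have B2: "B \<ge> 2" using False unfolding B_def by linarith
    have "real (B ^ 3) \<le> t ^ 3" using B by (simp add: power_mono)
    then have B3: "B ^ 3 \<le> \<tau>" unfolding t3 by (simp only: of_nat_le_iff)
    have B4: "B * B \<ge> 4" using mult_mono[OF B2 B2] by simp
    have A: "A > 0" "2 * A \<le> B * B" "B * B \<le> 3 * A" using B4 unfolding A_def by linarith+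
    have "A \<le> B * B" using A by linarith
    then have "A * B \<le> B ^ 3" by (simp add: power3_eq_cube)
    then have AB: "A * B \<le> \<tau>" using B3 by linarith
    have P0: "P \<ge> 0" using P by (simp add: prime_ge_0_int)
    have "int (\<tau> * B) ^ 3 = int \<tau> ^ 3 * int (B ^ 3)" by (simp add: power_mult_distrib)
    also have "\<dots> \<le> int \<tau> ^ 3 * int \<tau>" using B3 by (intro mult_left_mono) auto
    also have "\<dots> \<le> P ^ 3" using \<tau>P by (simp add: power_numeral_reduce mult_ac)
    finally have "int (\<tau> * B) \<le> P" using P0 by (simp add: power_mono_iff)
    then have "A * card X \<le> A + 2 * (\<tau> * B)"
      using moebius_roots_of_unity_bound[OF P abc A(1,2) AB _ X X12] by blast
    then have "real (A * card X) \<le> real (A + 2 * (\<tau> * B))" by (simp only: of_nat_le_iff)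
    \<comment> \<open>From \<open>t \<le> 2 * B\<close> and \<open>B * B \<le> 3 * A\<close> the
      second term is at most \<open>36 * A * t ^ 2\<close>; together with
      \<open>3 * A \<le> 3 * A * t ^ 2\<close> this gives 13 = 1 + 12.\<close>
    then have "3 * real A * real (card X) \<le> 3 * real A + 6 * t ^ 3 * real B" by (simp add: t3)
    also have "\<dots> \<le> 3 * real A + 6 * t ^ 3 * real B * (2 * real B / t)"
    proof -
      have "1 \<le> 2 * real B / t" using B t1 False by (simp add: field_simps)
      then have "6 * t ^ 3 * real B * 1 \<le> 6 * t ^ 3 * real B * (2 * real B / t)"
        using t1 by (intro mult_left_mono) auto
      then show ?thesis by simp
    qed
    also have "\<dots> = 3 * real A + 12 * t ^ 2 * real (B * B)"
      using t1 by (simp add: power3_eq_cube power2_eq_square)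
    also have "\<dots> \<le> 3 * real A * t ^ 2 + 12 * t ^ 2 * real (3 * A)"
      using A(3) t1 by (intro add_mono mult_left_mono mult_le_cancel_left1[THEN iffD2]) (auto simp del: of_nat_mult)
    also have "\<dots> = 3 * real A * (13 * t ^ 2)" by (simp add: algebra_simps)
    finally show ?thesis using A(1) by (simp add: t2)
  qed
qed

lemma card_le_mult_card_fibres:
  assumes "finite S" "finite T" "f ` S \<subseteq> T" "\<And>y. y \<in> T \<Longrightarrow> card {x \<in> S. f x = y} \<le> k"
  shows "card S \<le> k * card T"
proof -
  have "card S = (\<Sum>y\<in>T. card {x \<in> S. f x = y})"
    using sum.group[OF assms(1-3), of "\<lambda>_. 1::nat"] by simp
  also have "\<dots> \<le> k * card T" using sum_bounded_above[OF assms(4)] by (simp add: mult.commute)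
  finally show ?thesis .
qed

section \<open>Additive energies of a group of roots of unity\<close>

locale roots_of_unity_mod =
  fixes P :: int and \<tau> :: nat
  assumes P: "prime P" and \<tau>: "\<tau> > 0"
begin

definition roots :: "int set" where
  "roots = {h \<in> {0..<P}. [h ^ \<tau> = 1] (mod P)}"

text \<open>On \<open>roots\<close> a power of \<open>h\<close> serves as its inverse because
  \<open>h ^ \<tau>\<close> is 1; multiplicativity is then immediate.\<close>

definition root_inv :: "int \<Rightarrow> int" where
  "root_inv h = h ^ (\<tau> - 1) mod P"

lemma P1: "P > 1" using P by (rule prime_gt_1_int)

lemma finite_roots [simp]: "finite roots"
  unfolding roots_def by (rule finite_subset[of _ "{0..<P}"]) auto

lemma roots_eqI: "x \<in> {0..<P} \<Longrightarrow> y \<in> {0..<P} \<Longrightarrow> [x = y] (mod P) \<Longrightarrow> x = y"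
  by (auto intro: cong_less_imp_eq_int)

lemma roots_range: "x \<in> roots \<Longrightarrow> x \<in> {0..<P}" by (simp add: roots_def)

lemma roots_eq_iff: "x \<in> roots \<Longrightarrow> y \<in> roots \<Longrightarrow> x = y \<longleftrightarrow> P dvd x - y"
  using roots_eqI[of x y] by (auto simp: roots_def cong_iff_dvd_diff)

lemma roots_not_dvd: "x \<in> roots \<Longrightarrow> \<not> P dvd x"
proof
  assume x: "x \<in> roots" "P dvd x"
  then have "P dvd x ^ \<tau>" using \<tau> by (meson dvd_power dvd_trans)
  then have "P dvd 1" using x cong_dvd_iff[of "x ^ \<tau>" 1 P] by (simp add: roots_def)
  then show False using P1 by auto
qed

lemma one_in_roots [simp]: "1 \<in> roots" using P1 by (simp add: roots_def)

lemma mod_in_roots: "[h ^ \<tau> = 1] (mod P) \<Longrightarrow> h mod P \<in> roots"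
  using P1 by (simp add: roots_def cong_def power_mod)

lemma mult_in_roots: "x \<in> roots \<Longrightarrow> y \<in> roots \<Longrightarrow> x * y mod P \<in> roots"
  using cong_mult[of "x ^ \<tau>" 1 P "y ^ \<tau>" 1] by (intro mod_in_roots) (auto simp: roots_def power_mult_distrib)

lemma root_inv_in_roots: "x \<in> roots \<Longrightarrow> root_inv x \<in> roots"
  unfolding root_inv_def
  using cong_pow[of "x ^ \<tau>" 1 P "\<tau> - 1"]
  by (intro mod_in_roots) (auto simp: roots_def mult.commute simp flip: power_mult)

lemma root_inv: "x \<in> roots \<Longrightarrow> [x * root_inv x = 1] (mod P)"
  using \<tau> by (auto simp: root_inv_def roots_def cong_def mod_mult_right_eq simp flip: power_Suc)

lemma P_dvd_mult_iff: "P dvd x * y \<longleftrightarrow> P dvd x \<or> P dvd y"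
  using P by (rule prime_dvd_mult_iff)

text \<open>Lagrange's bound, as the case of simple zeros in the multiplicity count; the constant
  term \<open>- 1\<close> keeps \<open>x ^ \<tau> - 1\<close> from vanishing modulo
  \<open>P\<close>.\<close>

lemma card_roots_le: "card roots \<le> \<tau>"
proof -
  let ?f = "[:0, 1:] ^ \<tau> - 1 :: int poly"
  have d: "degree ?f \<le> \<tau>"
    by (intro degree_diff_le order_trans[OF degree_power_le]) auto
  have "coeff ?f 0 = - 1" using \<tau> by (simp add: coeff_0_power)
  then have "\<not> [:P:] dvd ?f" using P1 by (auto simp: const_poly_dvd_iff intro!: exI[of _ 0])
  moreover have "dvd_modulo P ([:- y, 1:] ^ 1) ?f" if "y \<in> roots" for y
    using that not_prime_unit[of P] P P1
    by (intro dvd_modulo_of_iterated_derivation[OF P, of 1])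
      (auto simp: roots_def poly_power cong_iff_dvd_diff)
  ultimately have "1 * card roots \<le> degree ?f"
    by (intro multiplicity_count_mod_prime[OF P]) (auto simp: roots_eq_iff)
  then show ?thesis using d by simp
qed

section \<open>Energy of sums of two roots\<close>

definition additive_quadruples where
  "additive_quadruples = {((h1, h2), (h3, h4)). h1 \<in> roots \<and> h2 \<in> roots \<and> h3 \<in> roots \<and> h4 \<in> roots \<and>
     [h1 + h2 = h3 + h4] (mod P) \<and>
     [root_inv h1 + root_inv h2 = root_inv h3 + root_inv h4] (mod P)}"

lemma sum_prod_mod_eq:
  assumes "h1 \<in> roots" "h2 \<in> roots" "h3 \<in> roots" "h4 \<in> roots"
    and s: "[h1 + h2 = h3 + h4] (mod P)" and m: "[h1 * h2 = h3 * h4] (mod P)"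
  shows "(h1 = h3 \<and> h2 = h4) \<or> (h1 = h4 \<and> h2 = h3)"
proof -
  have "(h1 - h3) * (h1 - h4) = h1 * ((h1 + h2) - (h3 + h4)) - (h1 * h2 - h3 * h4)"
    by (simp add: algebra_simps)
  then have "P dvd (h1 - h3) * (h1 - h4)" using s m by (auto simp: cong_iff_dvd_diff)
  then consider "P dvd h1 - h3" | "P dvd h1 - h4" by (auto simp: P_dvd_mult_iff)
  then show ?thesis
  proof cases
    case 1
    have "h2 - h4 = (h1 + h2 - (h3 + h4)) - (h1 - h3)" by simp
    then have "P dvd h2 - h4" using 1 s by (metis cong_iff_dvd_diff dvd_diff)
    then show ?thesis using 1 assms by (simp add: roots_eq_iff)
  next
    case 2
    have "h2 - h3 = (h1 + h2 - (h3 + h4)) - (h1 - h4)" by simp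
    then have "P dvd h2 - h3" using 2 s by (metis cong_iff_dvd_diff dvd_diff)
    then show ?thesis using 2 assms by (simp add: roots_eq_iff)
  qed
qed

text \<open>With \<open>s = h1 + h2\<close> the equation for the inverses reads
  \<open>s / (h1 h2) = s / (h3 h4)\<close>. Either \<open>s\<close> is 0 and both pairs are
  opposite, or the products agree as well and the pairs coincide up to order. Each of the three
  families has at most \<open>\<tau> ^ 2\<close> members.\<close>

lemma card_additive_quadruples: "card additive_quadruples \<le> 3 * \<tau> ^ 2"
proof -
  let ?R = "roots \<times> roots"
  have "additive_quadruples \<subseteq> (\<lambda>(x, y). ((x, y), (x, y))) ` ?R \<union> (\<lambda>(x, y). ((x, y), (y, x))) ` ?R
     \<union> (\<lambda>(x, y). ((x, - x mod P), (y, - y mod P))) ` ?R"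
  proof
    fix q assume "q \<in> additive_quadruples"
    then obtain h1 h2 h3 h4 where q: "q = ((h1, h2), (h3, h4))"
      and h: "h1 \<in> roots" "h2 \<in> roots" "h3 \<in> roots" "h4 \<in> roots"
      and s: "[h1 + h2 = h3 + h4] (mod P)"
      and r: "[root_inv h1 + root_inv h2 = root_inv h3 + root_inv h4] (mod P)"
      by (auto simp: additive_quadruples_def)
    let ?k1 = "root_inv h1" and ?k2 = "root_inv h2" and ?k3 = "root_inv h3" and ?k4 = "root_inv h4"
    have k: "P dvd h1 * ?k1 - 1" "P dvd h2 * ?k2 - 1" "P dvd h3 * ?k3 - 1" "P dvd h4 * ?k4 - 1"
      using root_inv h by (auto simp: cong_iff_dvd_diff)
    have s': "P dvd h1 + h2 - (h3 + h4)" and r': "P dvd ?k1 + ?k2 - (?k3 + ?k4)"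
      using s r by (auto simp: cong_iff_dvd_diff)
    \<comment> \<open>Up to sign and modulo \<open>P\<close> this is the equation for the inverses
      multiplied by \<open>h1 * h2 * h3 * h4\<close>; the remaining terms replace products of a root
      and its inverse by 1.\<close>
    have "(h1 + h2) * (h1 * h2 - h3 * h4) = h1 * h2 * (h2 * (h1 * ?k1 - 1) + h1 * (h2 * ?k2 - 1)
        - h3 * h4 * (?k1 + ?k2 - (?k3 + ?k4)) - h4 * (h3 * ?k3 - 1) - h3 * (h4 * ?k4 - 1) + (h1 + h2 - (h3 + h4)))
        - (h1 * h2 - h3 * h4) * (h2 * (h1 * ?k1 - 1) + h1 * (h2 * ?k2 - 1))"
      by (simp add: algebra_simps)
    also have "P dvd \<dots>"
      by (intro dvd_diff dvd_mult dvd_add k s' r')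
    finally have "P dvd (h1 + h2) * (h1 * h2 - h3 * h4)" .
    then consider "P dvd h1 + h2" | "P dvd h1 * h2 - h3 * h4" by (auto simp: P_dvd_mult_iff)
    then show "q \<in> (\<lambda>(x, y). ((x, y), (x, y))) ` ?R \<union> (\<lambda>(x, y). ((x, y), (y, x))) ` ?R
     \<union> (\<lambda>(x, y). ((x, - x mod P), (y, - y mod P))) ` ?R"
    proof cases
      case 1
      then have "P dvd h3 + h4" using s' by (metis dvd_diff_commute dvd_add_right_iff diff_add_cancel)
      have neg: "y = - x mod P" if "P dvd x + y" "y \<in> roots" for x y
      proof (rule roots_eqI)
        show "[y = - x mod P] (mod P)" using that by (simp add: cong_def mod_eq_dvd_iff add.commute)
        have "0 < P" using P1 by simp
        then show "- x mod P \<in> {0..<P}" by (simp add: pos_mod_bound pos_mod_sign)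
      qed (use roots_range that in auto)
      show ?thesis using neg[OF 1] neg[OF \<open>P dvd h3 + h4\<close>] h q by auto
    next
      case 2
      then show ?thesis using sum_prod_mod_eq[OF h s] h q by (auto simp: cong_iff_dvd_diff)
    qed
  qed
  then have "card additive_quadruples \<le> card ((\<lambda>(x, y). ((x, y), (x, y))) ` ?R \<union> (\<lambda>(x, y). ((x, y), (y, x))) ` ?R
     \<union> (\<lambda>(x, y). ((x, - x mod P), (y, - y mod P))) ` ?R)"
    by (intro card_mono) auto
  also have "\<dots> \<le> card ?R + card ?R + card ?R"
    by (intro order_trans[OF card_Un_le] add_mono card_image_le) auto
  also have "\<dots> \<le> 3 * \<tau> ^ 2"
    using mult_mono[OF card_roots_le card_roots_le] by (simp add: card_cartesian_product power2_eq_square)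
  finally show ?thesis .
qed

section \<open>Points on a family of Moebius curves\<close>

definition moebius_curve where
  "moebius_curve = {(\<alpha>, \<beta>, x, w). \<alpha> \<in> roots \<and> \<beta> \<in> roots \<and> x \<in> roots \<and> w \<in> roots \<and>
     [w * (- \<alpha> * (\<beta> - 1) * x - \<beta> * (\<alpha> - 1)) = \<alpha> * x * ((\<alpha> - 1) * x + (\<beta> - 1))] (mod P)}"

lemma card_roots2: "card (roots \<times> roots) \<le> \<tau> ^ 2"
  using mult_mono[OF card_roots_le card_roots_le] by (simp add: card_cartesian_product power2_eq_square)

lemma card_image_roots2:
  assumes "S \<subseteq> f ` (roots \<times> roots)"
  shows "card S \<le> \<tau> ^ 2"
  using card_mono[OF _ assms] card_image_le[of "roots \<times> roots" f] card_roots2 by simp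

lemma card_inj_roots2:
  assumes "inj_on f S" "f ` S \<subseteq> roots \<times> roots"
  shows "card S \<le> \<tau> ^ 2"
  using card_inj_on_le[OF assms] card_roots2 by simp

lemma finite_moebius_curve: "finite moebius_curve"
  by (rule finite_subset[of _ "roots \<times> roots \<times> roots \<times> roots"]) (auto simp: moebius_curve_def)

text \<open>For fixed \<open>\<alpha>\<close>, \<open>\<beta>\<close> the equation says that
  \<open>w / (\<alpha> x)\<close> is the Moebius transform \<open>N / M\<close> of \<open>x\<close>.
  Taking \<open>\<tau>\<close>-th powers removes the roots of unity and puts \<open>x\<close> into
  \<open>X \<alpha> \<beta>\<close>, where Stepanov's bound applies unless the pair is special.
  Special pairs are counted directly; the delicate points are those with \<open>M = N = 0\<close>,
  which leave \<open>w\<close> free.\<close>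

lemma card_moebius_curve:
  assumes \<tau>P: "int \<tau> ^ 4 \<le> P ^ 3"
  shows "real (card moebius_curve) \<le> 20 * \<tau> powr (8/3)"
proof -
  define N where "N \<alpha> \<beta> x = (\<alpha> - 1) * x + (\<beta> - 1)" for \<alpha> \<beta> x :: int
  define M where "M \<alpha> \<beta> x = - \<alpha> * (\<beta> - 1) * x - \<beta> * (\<alpha> - 1)" for \<alpha> \<beta> x :: int
  \<comment> \<open>For roots these are exactly the pairs where a coefficient of the transform or
    its determinant \<open>(\<alpha> * \<beta> - 1) * (\<beta> - \<alpha>)\<close> vanishes modulo
    \<open>P\<close>.\<close>
  define special where "special \<alpha> \<beta> \<longleftrightarrow> \<alpha> = 1 \<or> \<beta> = 1 \<or> \<beta> = \<alpha> \<or> \<beta> = root_inv \<alpha>" for \<alpha> \<beta>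
  have curve: "\<alpha> \<in> roots" "\<beta> \<in> roots" "x \<in> roots" "w \<in> roots"
      "P dvd w * M \<alpha> \<beta> x - \<alpha> * x * N \<alpha> \<beta> x" if "(\<alpha>, \<beta>, x, w) \<in> moebius_curve" for \<alpha> \<beta> x w
    using that by (auto simp: moebius_curve_def M_def N_def cong_iff_dvd_diff)
  have nd: "\<not> P dvd \<alpha> - 1" if "\<alpha> \<in> roots" "\<alpha> \<noteq> 1" for \<alpha>
    using that roots_eq_iff[of \<alpha> 1] by simp
  have det: "P dvd (\<alpha> * \<beta> - 1) * (\<beta> - \<alpha>) \<longleftrightarrow> \<beta> = \<alpha> \<or> \<beta> = root_inv \<alpha>" if "\<alpha> \<in> roots" "\<beta> \<in> roots" for \<alpha> \<beta>
  proof -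
    have i: "P dvd \<alpha> * root_inv \<alpha> - 1" using root_inv[OF that(1)] by (simp add: cong_iff_dvd_diff)
    have "\<alpha> * \<beta> - 1 = \<alpha> * (\<beta> - root_inv \<alpha>) + (\<alpha> * root_inv \<alpha> - 1)" by (simp add: algebra_simps)
    then have "P dvd \<alpha> * \<beta> - 1 \<longleftrightarrow> P dvd \<alpha> * (\<beta> - root_inv \<alpha>)" by (simp only: dvd_add_left_iff[OF i])
    also have "\<dots> \<longleftrightarrow> \<beta> = root_inv \<alpha>"
      using that root_inv_in_roots roots_not_dvd by (simp add: P_dvd_mult_iff roots_eq_iff)
    finally show ?thesis using that by (auto simp: P_dvd_mult_iff roots_eq_iff)
  qed
  have MN: "P dvd N \<alpha> \<beta> x" if "(\<alpha>, \<beta>, x, w) \<in> moebius_curve" "P dvd M \<alpha> \<beta> x" for \<alpha> \<beta> x w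
  proof -
    have "P dvd \<alpha> * x * N \<alpha> \<beta> x"
      using curve(5)[OF that(1)] that(2) by (metis dvd_diff_right_iff dvd_mult)
    then show ?thesis using curve[OF that(1)] roots_not_dvd by (auto simp: P_dvd_mult_iff)
  qed
  have MN_det: "P dvd (\<alpha> * \<beta> - 1) * (\<beta> - \<alpha>)" if "P dvd M \<alpha> \<beta> x" "P dvd N \<alpha> \<beta> x" for \<alpha> \<beta> x
  proof -
    have "(\<alpha> * \<beta> - 1) * (\<beta> - \<alpha>) = (\<alpha> - 1) * M \<alpha> \<beta> x + \<alpha> * (\<beta> - 1) * N \<alpha> \<beta> x"
      by (simp add: M_def N_def algebra_simps)
    then show ?thesis using that by simp
  qed
  have w_unique: "w = w'" if "(\<alpha>, \<beta>, x, w) \<in> moebius_curve" "(\<alpha>, \<beta>, x, w') \<in> moebius_curve" "\<not> P dvd M \<alpha> \<beta> x"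
    for \<alpha> \<beta> x w w'
  proof -
    have "(w - w') * M \<alpha> \<beta> x = (w * M \<alpha> \<beta> x - \<alpha> * x * N \<alpha> \<beta> x) - (w' * M \<alpha> \<beta> x - \<alpha> * x * N \<alpha> \<beta> x)"
      by (simp add: algebra_simps)
    also have "P dvd \<dots>" by (intro dvd_diff curve(5) that)
    finally show ?thesis using that(3) curve(4)[OF that(1)] curve(4)[OF that(2)]
      by (simp add: P_dvd_mult_iff roots_eq_iff)
  qed
  define X where "X \<alpha> \<beta> = {x \<in> roots. [N \<alpha> \<beta> x ^ \<tau> = M \<alpha> \<beta> x ^ \<tau>] (mod P)}" for \<alpha> \<beta>
  have cardX: "real (card (X \<alpha> \<beta>)) \<le> 13 * \<tau> powr (2/3)" if "\<alpha> \<in> roots" "\<beta> \<in> roots" "\<not> special \<alpha> \<beta>" for \<alpha> \<beta>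
  proof (rule moebius_roots_of_unity_bound_powr[OF P _ _ _ _ \<tau> \<tau>P])
    show "\<not> P dvd \<alpha> - 1" "\<not> P dvd \<beta> - 1" using nd that by (auto simp: special_def)
    then show "\<not> P dvd - \<alpha> * (\<beta> - 1)" using roots_not_dvd that by (simp add: P_dvd_mult_iff)
    have "(\<alpha> - 1) * (- \<beta> * (\<alpha> - 1)) - (\<beta> - 1) * (- \<alpha> * (\<beta> - 1)) = (\<alpha> * \<beta> - 1) * (\<beta> - \<alpha>)"
      by (simp add: algebra_simps)
    then show "\<not> P dvd (\<alpha> - 1) * (- \<beta> * (\<alpha> - 1)) - (\<beta> - 1) * (- \<alpha> * (\<beta> - 1))"
      using det that by (simp add: special_def)
    show "finite (X \<alpha> \<beta>)" by (simp add: X_def)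
    show "card (X \<alpha> \<beta>) \<le> \<tau>"
      using card_mono[of roots "X \<alpha> \<beta>"] card_roots_le by (auto simp: X_def)
  qed (auto simp: X_def roots_eq_iff N_def M_def roots_def algebra_simps)
  define U1 where "U1 = {(\<alpha>, \<beta>, x, w) \<in> moebius_curve. \<not> special \<alpha> \<beta>}"
  define U2 where "U2 = {(\<alpha>, \<beta>, x, w) \<in> moebius_curve. special \<alpha> \<beta> \<and> \<not> P dvd M \<alpha> \<beta> x}"
  define U3 where "U3 = {(\<alpha>, \<beta>, x, w) \<in> moebius_curve. special \<alpha> \<beta> \<and> P dvd M \<alpha> \<beta> x}"
  let ?pr = "\<lambda>(\<alpha>, \<beta>, x, w). ((\<alpha>, \<beta>), x)"
  have "real (card U1) \<le> \<tau> ^ 2 * (13 * \<tau> powr (2/3))"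
  proof -
    define S where "S = {(\<alpha>, \<beta>) \<in> roots \<times> roots. \<not> special \<alpha> \<beta>}"
    have S: "S \<subseteq> roots \<times> roots" by (auto simp: S_def)
    then have finS: "finite S" by (rule finite_subset) auto
    have nM: "\<not> P dvd M \<alpha> \<beta> x" if "(\<alpha>, \<beta>, x, w) \<in> U1" for \<alpha> \<beta> x w
    proof
      assume M: "P dvd M \<alpha> \<beta> x"
      have c: "(\<alpha>, \<beta>, x, w) \<in> moebius_curve" "\<not> special \<alpha> \<beta>" using that by (auto simp: U1_def)
      then show False using MN_det[OF M MN[OF c(1) M]] det[OF curve(1,2)[OF c(1)]]
        by (simp add: special_def)
    qed
    have "inj_on ?pr U1"
      using nM w_unique by (auto simp: inj_on_def U1_def)
    moreover have "?pr ` U1 \<subseteq> (SIGMA (\<alpha>, \<beta>):S. X \<alpha> \<beta>)"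
    proof
      fix y assume "y \<in> ?pr ` U1"
      then obtain \<alpha> \<beta> x w where u: "(\<alpha>, \<beta>, x, w) \<in> U1" and y: "y = ((\<alpha>, \<beta>), x)" by auto
      then have c: "(\<alpha>, \<beta>, x, w) \<in> moebius_curve" by (simp add: U1_def)
      have "[(w * M \<alpha> \<beta> x) ^ \<tau> = (\<alpha> * x * N \<alpha> \<beta> x) ^ \<tau>] (mod P)"
        using curve[OF c] by (intro cong_pow) (simp add: cong_iff_dvd_diff)
      then have "[w ^ \<tau> * M \<alpha> \<beta> x ^ \<tau> = \<alpha> ^ \<tau> * x ^ \<tau> * N \<alpha> \<beta> x ^ \<tau>] (mod P)"
        by (simp add: power_mult_distrib)
      moreover have "[w ^ \<tau> * M \<alpha> \<beta> x ^ \<tau> = 1 * M \<alpha> \<beta> x ^ \<tau>] (mod P)"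
        using curve[OF c] by (intro cong_mult) (auto simp: roots_def)
      moreover have "[\<alpha> ^ \<tau> * x ^ \<tau> * N \<alpha> \<beta> x ^ \<tau> = 1 * 1 * N \<alpha> \<beta> x ^ \<tau>] (mod P)"
        using curve[OF c] by (intro cong_mult) (auto simp: roots_def)
      ultimately have "[N \<alpha> \<beta> x ^ \<tau> = M \<alpha> \<beta> x ^ \<tau>] (mod P)"
        by (simp add: cong_def)
      then show "y \<in> (SIGMA (\<alpha>, \<beta>):S. X \<alpha> \<beta>)"
        unfolding y using u curve[OF c] by (auto simp: S_def X_def U1_def)
    qed
    moreover have "finite (SIGMA (\<alpha>, \<beta>):S. X \<alpha> \<beta>)"
      using finS by (intro finite_SigmaI) (auto simp: X_def)
    ultimately have "card U1 \<le> card (SIGMA (\<alpha>, \<beta>):S. X \<alpha> \<beta>)"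
      by (rule card_inj_on_le)
    also have "\<dots> = (\<Sum>(\<alpha>, \<beta>)\<in>S. card (X \<alpha> \<beta>))"
      using finS by (subst card_SigmaI) (auto simp: X_def case_prod_unfold)
    finally have "real (card U1) \<le> (\<Sum>(\<alpha>, \<beta>)\<in>S. real (card (X \<alpha> \<beta>)))"
      by (simp add: case_prod_unfold flip: of_nat_sum)
    also have "\<dots> \<le> (\<Sum>_\<in>S. 13 * \<tau> powr (2/3))"
      using cardX by (intro sum_mono) (auto simp: S_def)
    also have "\<dots> = real (card S) * (13 * \<tau> powr (2/3))" by simp
    also have "\<dots> \<le> real (\<tau> ^ 2) * (13 * \<tau> powr (2/3))"
      using card_mono[OF _ S] card_roots2 by (intro mult_right_mono) (auto simp flip: of_nat_power)
    finally show ?thesis by simp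
  qed
  moreover have "card U2 \<le> 4 * \<tau> ^ 2"
  proof -
    have pU2: "\<alpha> \<in> roots" "\<beta> \<in> roots" "x \<in> roots" "special \<alpha> \<beta>" if "(\<alpha>, \<beta>, x, w) \<in> U2" for \<alpha> \<beta> x w
      using that curve unfolding U2_def by blast+
    have "inj_on ?pr U2"
      using w_unique by (auto simp: inj_on_def U2_def)
    then have "card U2 = card (?pr ` U2)" by (simp add: card_image)
    also have "\<dots> \<le> card ((\<lambda>(\<beta>, x). ((1, \<beta>), x)) ` (roots \<times> roots) \<union> (\<lambda>(\<alpha>, x). ((\<alpha>, 1), x)) ` (roots \<times> roots)
        \<union> (\<lambda>(\<alpha>, x). ((\<alpha>, \<alpha>), x)) ` (roots \<times> roots) \<union> (\<lambda>(\<alpha>, x). ((\<alpha>, root_inv \<alpha>), x)) ` (roots \<times> roots))"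
    proof (intro card_mono subsetI)
      fix y assume "y \<in> ?pr ` U2"
      then obtain \<alpha> \<beta> x w where y: "y = ((\<alpha>, \<beta>), x)" "(\<alpha>, \<beta>, x, w) \<in> U2" by auto
      show "y \<in> (\<lambda>(\<beta>, x). ((1, \<beta>), x)) ` (roots \<times> roots) \<union> (\<lambda>(\<alpha>, x). ((\<alpha>, 1), x)) ` (roots \<times> roots)
        \<union> (\<lambda>(\<alpha>, x). ((\<alpha>, \<alpha>), x)) ` (roots \<times> roots) \<union> (\<lambda>(\<alpha>, x). ((\<alpha>, root_inv \<alpha>), x)) ` (roots \<times> roots)"
        using pU2[OF y(2)] y(1) by (auto simp: special_def)
    qed auto
    also have "\<dots> \<le> \<tau> ^ 2 + \<tau> ^ 2 + \<tau> ^ 2 + \<tau> ^ 2"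
      by (intro order_trans[OF card_Un_le] add_mono card_image_roots2) auto
    finally show ?thesis by simp
  qed
  moreover have "card U3 \<le> 3 * \<tau> ^ 2"
  proof -
    have U3: "(\<alpha>, \<beta>, x, w) \<in> moebius_curve" "\<alpha> \<in> roots" "\<beta> \<in> roots" "x \<in> roots" "w \<in> roots" "P dvd N \<alpha> \<beta> x"
      "\<beta> = \<alpha> \<or> \<beta> = root_inv \<alpha>" if "(\<alpha>, \<beta>, x, w) \<in> U3" for \<alpha> \<beta> x w
    proof -
      show c: "(\<alpha>, \<beta>, x, w) \<in> moebius_curve" using that by (simp add: U3_def)
      show m: "\<alpha> \<in> roots" "\<beta> \<in> roots" "x \<in> roots" "w \<in> roots" using curve[OF c] by auto
      show n: "P dvd N \<alpha> \<beta> x" using that MN by (auto simp: U3_def)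
      show "\<beta> = \<alpha> \<or> \<beta> = root_inv \<alpha>" using that n MN_det det[OF m(1,2)] by (auto simp: U3_def)
    qed
    \<comment> \<open>The counterpart of \<open>w_unique\<close>: where \<open>M\<close> and
      \<open>N\<close> both vanish, \<open>w\<close> is free, but \<open>N = 0\<close> is a linear
      equation for \<open>x\<close> with leading coefficient \<open>\<alpha> - 1\<close>.\<close>
    have x_unique: "x = x'" if "(\<alpha>, \<beta>, x, w) \<in> U3" "(\<alpha>, \<beta>, x', w') \<in> U3" "\<alpha> \<noteq> 1" for \<alpha> \<beta> x x' w w'
    proof -
      have "(\<alpha> - 1) * (x - x') = N \<alpha> \<beta> x - N \<alpha> \<beta> x'" by (simp add: N_def algebra_simps)
      also have "P dvd \<dots>" using U3(6) that by (intro dvd_diff) blast+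
      finally have "P dvd x - x'" using nd[of \<alpha>] U3(2)[OF that(1)] that(3) by (auto simp: P_dvd_mult_iff)
      then show ?thesis using roots_eq_iff U3(4) that by blast
    qed
    \<comment> \<open>For \<open>\<alpha> = 1\<close> the equation \<open>N = 0\<close> forces
      \<open>\<beta> = 1\<close> and leaves \<open>x\<close> and \<open>w\<close> free. Otherwise
      \<open>\<beta>\<close> is one of two functions of \<open>\<alpha>\<close>, and the free
      parameters are \<open>\<alpha>\<close> and \<open>w\<close>.\<close>
    define V1 where "V1 = {(\<alpha>, \<beta>, x, w) \<in> U3. \<alpha> = 1}"
    define V2 where "V2 = {(\<alpha>, \<beta>, x, w) \<in> U3. \<alpha> \<noteq> 1 \<and> \<beta> = \<alpha>}"
    define V3 where "V3 = {(\<alpha>, \<beta>, x, w) \<in> U3. \<alpha> \<noteq> 1 \<and> \<beta> = root_inv \<alpha>}"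
    have "U3 = V1 \<union> V2 \<union> V3" using U3(7) unfolding V1_def V2_def V3_def by blast
    moreover have "card V1 \<le> \<tau> ^ 2"
    proof (rule card_image_roots2)
      show "V1 \<subseteq> (\<lambda>(x, w). (1, 1, x, w)) ` (roots \<times> roots)"
      proof clarify
        fix \<alpha> \<beta> x w assume "(\<alpha>, \<beta>, x, w) \<in> V1"
        then have u: "(\<alpha>, \<beta>, x, w) \<in> U3" "\<alpha> = 1" by (auto simp: V1_def)
        have "P dvd \<beta> - 1" using U3(6)[OF u(1)] u(2) by (simp add: N_def)
        then have "\<beta> = 1" using nd U3(3)[OF u(1)] by blast
        then show "(\<alpha>, \<beta>, x, w) \<in> (\<lambda>(x, w). (1, 1, x, w)) ` (roots \<times> roots)"
          using u U3(4,5)[OF u(1)] by auto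
      qed
    qed
    moreover have "card V2 \<le> \<tau> ^ 2"
    proof (rule card_inj_roots2)
      show "inj_on (\<lambda>(\<alpha>, \<beta>, x, w). (\<alpha>, w)) V2"
        using x_unique by (auto simp: inj_on_def V2_def)
      show "(\<lambda>(\<alpha>, \<beta>, x, w). (\<alpha>, w)) ` V2 \<subseteq> roots \<times> roots" using U3 by (auto simp: V2_def)
    qed
    moreover have "card V3 \<le> \<tau> ^ 2"
    proof (rule card_inj_roots2)
      show "inj_on (\<lambda>(\<alpha>, \<beta>, x, w). (\<alpha>, w)) V3"
        using x_unique by (auto simp: inj_on_def V3_def)
      show "(\<lambda>(\<alpha>, \<beta>, x, w). (\<alpha>, w)) ` V3 \<subseteq> roots \<times> roots" using U3 by (auto simp: V3_def)
    qed
    ultimately show ?thesis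
      using card_Un_le[of "V1 \<union> V2" V3] card_Un_le[of V1 V2] by simp
  qed
  moreover have "moebius_curve = U1 \<union> U2 \<union> U3" by (auto simp: U1_def U2_def U3_def)
  then have "card moebius_curve \<le> card U1 + card U2 + card U3"
    using card_Un_le[of "U1 \<union> U2" U3] card_Un_le[of U1 U2] by simp
  \<comment> \<open>The generic pairs contribute the 13, the special ones 4 + 3 at the lower order
    \<open>\<tau> ^ 2\<close>; this adds up to 20.\<close>
  ultimately have "real (card moebius_curve) \<le> \<tau> ^ 2 * (13 * \<tau> powr (2/3)) + 7 * real \<tau> ^ 2"
    using of_nat_mono[of "card U2" "4 * \<tau> ^ 2", where 'a = real] of_nat_mono[of "card U3" "3 * \<tau> ^ 2", where 'a = real]
    by (simp flip: of_nat_power)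
  also have "\<dots> \<le> \<tau> ^ 2 * (13 * \<tau> powr (2/3)) + 7 * real \<tau> ^ 2 * \<tau> powr (2/3)"
    using \<tau> by (intro add_left_mono mult_le_cancel_left1[THEN iffD2]) (auto intro: ge_one_powr_ge_zero)
  also have "\<dots> = 20 * (real \<tau> powr 2 * \<tau> powr (2/3))" using \<tau> by simp
  also have "\<dots> = 20 * \<tau> powr (8/3)" by (subst powr_add[symmetric]) simp
  finally show ?thesis .
qed

section \<open>Energy of sums of three roots\<close>

definition additive_sextuples where
  "additive_sextuples = {((h1, h2, h3), (h4, h5, h6)).
     h1 \<in> roots \<and> h2 \<in> roots \<and> h3 \<in> roots \<and> h4 \<in> roots \<and> h5 \<in> roots \<and> h6 \<in> roots \<and>
     [h1 + h2 + h3 = h4 + h5 + h6] (mod P) \<and>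
     [root_inv h1 + root_inv h2 + root_inv h3 = root_inv h4 + root_inv h5 + root_inv h6] (mod P)}"

lemma triple_pair_cases:
  obtains h1 h2 h3 h4 h5 h6 where "q = ((h1, h2, h3), (h4, h5, h6))"
proof -
  obtain h1 h2 h3 where "fst q = (h1, h2, h3)" by (rule prod_cases3)
  moreover obtain h4 h5 h6 where "snd q = (h4, h5, h6)" by (rule prod_cases3)
  ultimately show thesis using that by (metis prod.collapse)
qed

lemma moebius_curve_identity:
  fixes h1 h2 h3 h4 h5 g k1 k2 k3 k4 k5 k6 \<alpha> \<beta> x w :: int
  assumes a1: "P dvd h1 - \<alpha> * x * g" and a4: "P dvd h4 - x * g" and a5: "P dvd h5 - w * g"
    and m: "P dvd h2 * h3 - \<beta> * w * g ^ 2"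
    and s: "P dvd h1 + h2 + h3 - (h4 + h5 + g)" and t: "P dvd k1 + k2 + k3 - (k4 + k5 + k6)"
    and i1: "P dvd h1 * k1 - 1" and i2: "P dvd h2 * k2 - 1" and i3: "P dvd h3 * k3 - 1"
    and i4: "P dvd h4 * k4 - 1" and i5: "P dvd h5 * k5 - 1" and i6: "P dvd g * k6 - 1"
  shows "P dvd w * (- \<alpha> * (\<beta> - 1) * x - \<beta> * (\<alpha> - 1)) - \<alpha> * x * ((\<alpha> - 1) * x + (\<beta> - 1))"
proof -
  \<comment> \<open>\<open>g * Y\<close> is the value of \<open>h2 + h3\<close> prescribed by the
    first equation. Dividing by \<open>h2 h3 = \<beta> w g^2\<close> gives
    \<open>k2 + k3 = Y / (\<beta> w g)\<close>, which is the fact \<open>K\<close>.\<close>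
  define Y where "Y = x + w + 1 - \<alpha> * x"
  have c1: "P dvd \<alpha> * x * g * k1 - 1"
    using dvd_diff[OF i1 dvd_mult2[OF a1, of k1]] by (simp add: algebra_simps)
  have c4: "P dvd x * g * k4 - 1"
    using dvd_diff[OF i4 dvd_mult2[OF a4, of k4]] by (simp add: algebra_simps)
  have c5: "P dvd w * g * k5 - 1"
    using dvd_diff[OF i5 dvd_mult2[OF a5, of k5]] by (simp add: algebra_simps)
  have "P dvd h2 * k2 * h3 * k3 - 1"
    using dvd_add[OF dvd_mult2[OF i2, of "h3 * k3"] i3] by (simp add: algebra_simps)
  then have c23: "P dvd \<beta> * w * g ^ 2 * k2 * k3 - 1"
    using dvd_diff[OF _ dvd_mult2[OF m, of "k2 * k3"]] by (fastforce simp: algebra_simps)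
  have \<sigma>: "P dvd h2 + h3 - g * Y"
    using dvd_add[OF dvd_diff[OF s a1] dvd_add[OF a4 a5]] by (simp add: Y_def algebra_simps)
  have k: "P dvd k2 + k3 - k2 * k3 * (h2 + h3)"
    using dvd_add[OF dvd_mult[OF i3, of "- k2"] dvd_mult[OF i2, of "- k3"]] by (simp add: algebra_simps)
  have "P dvd k2 + k3 - k2 * k3 * (g * Y)"
    using dvd_add[OF k dvd_mult[OF \<sigma>, of "k2 * k3"]] by (simp add: algebra_simps)
  then have "P dvd g * w * \<beta> * (k2 + k3 - k2 * k3 * (g * Y)) + Y * (\<beta> * w * g ^ 2 * k2 * k3 - 1)"
    using c23 by (intro dvd_add dvd_mult)
  then have K: "P dvd g * w * \<beta> * (k2 + k3) - Y"
    by (simp add: algebra_simps power2_eq_square)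
  \<comment> \<open>This is the equation for the inverses multiplied by
    \<open>g * \<alpha> * x * w * \<beta>\<close>, with the inverses eliminated by means of
    \<open>c1\<close>, \<open>K\<close>, \<open>c4\<close>, \<open>c5\<close> and
    \<open>i6\<close>.\<close>
  have "w * (- \<alpha> * (\<beta> - 1) * x - \<beta> * (\<alpha> - 1)) - \<alpha> * x * ((\<alpha> - 1) * x + (\<beta> - 1)) =
    g * \<alpha> * x * w * \<beta> * (k1 + k2 + k3 - (k4 + k5 + k6)) - w * \<beta> * (\<alpha> * x * g * k1 - 1)
    - \<alpha> * x * (g * w * \<beta> * (k2 + k3) - Y) + \<alpha> * w * \<beta> * (x * g * k4 - 1)
    + \<alpha> * x * \<beta> * (w * g * k5 - 1) + \<alpha> * x * w * \<beta> * (g * k6 - 1)"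
    by (simp add: Y_def algebra_simps)
  also have "P dvd \<dots>" by (intro dvd_add dvd_diff dvd_mult t c1 K c4 c5 i6)
  finally show ?thesis .
qed

text \<open>Normalise by \<open>h6\<close> and fix \<open>\<alpha> = h1 / h4\<close> and \<open>\<beta> = h2 h3 / (h5 h6)\<close>: then \<open>h2 + h3\<close> is determined by
  the first equation and the second one becomes linear in \<open>w = h5 / h6\<close>, so that \<open>w\<close> is a Moebius
  transform of \<open>x = h4 / h6\<close> up to the factor \<open>\<alpha> x\<close>.\<close>

lemma card_additive_sextuples:
  assumes \<tau>P: "int \<tau> ^ 4 \<le> P ^ 3"
  shows "real (card additive_sextuples) \<le> 40 * \<tau> powr (11/3)"
proof -
  define f where "f = (\<lambda>((h1, h2, h3), (h4, h5, h6)). (h6, h1 * root_inv h4 mod P,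
    (h2 * h3 mod P) * (root_inv h5 * root_inv h6 mod P) mod P, h4 * root_inv h6 mod P, h5 * root_inv h6 mod P))"
  have inv: "P dvd h * root_inv h - 1" if "h \<in> roots" for h
    using root_inv[OF that] by (simp add: cong_iff_dvd_diff)
  have quot: "P dvd a - (a * root_inv b mod P) * b" if "b \<in> roots" for a b
  proof -
    have "[(a * root_inv b mod P) * b = a * (b * root_inv b)] (mod P)"
      by (simp only: cong_def mod_mult_left_eq) (simp only: mult_ac)
    also have "[a * (b * root_inv b) = a * 1] (mod P)"
      by (intro cong_mult cong_refl root_inv that)
    finally show ?thesis by (simp add: cong_iff_dvd_diff dvd_diff_commute)
  qed
  have fD: "P dvd h1 - \<alpha> * x * g" "P dvd h4 - x * g" "P dvd h5 - w * g" "P dvd h2 * h3 - \<beta> * w * g ^ 2" "g = h6"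
     "\<alpha> \<in> roots" "\<beta> \<in> roots" "x \<in> roots" "w \<in> roots" "g \<in> roots"
    if q: "((h1, h2, h3), (h4, h5, h6)) \<in> additive_sextuples" and f: "f ((h1, h2, h3), (h4, h5, h6)) = (g, \<alpha>, \<beta>, x, w)"
    for h1 h2 h3 h4 h5 h6 g \<alpha> \<beta> x w
  proof -
    have h: "h1 \<in> roots" "h2 \<in> roots" "h3 \<in> roots" "h4 \<in> roots" "h5 \<in> roots" "h6 \<in> roots"
      using q by (auto simp: additive_sextuples_def)
    have e: "g = h6" "\<alpha> = h1 * root_inv h4 mod P" "x = h4 * root_inv h6 mod P" "w = h5 * root_inv h6 mod P"
      and \<beta>: "\<beta> = (h2 * h3 mod P) * (root_inv h5 * root_inv h6 mod P) mod P" using f by (auto simp: f_def)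
    show "g = h6" "g \<in> roots" using e h by auto
    show "\<alpha> \<in> roots" "x \<in> roots" "w \<in> roots" unfolding e by (intro mult_in_roots root_inv_in_roots h)+
    show "\<beta> \<in> roots" unfolding \<beta> by (intro mult_in_roots root_inv_in_roots h)
    show x: "P dvd h4 - x * g" and w: "P dvd h5 - w * g" unfolding e by (intro quot h)+
    have "P dvd h1 - \<alpha> * h4" unfolding e by (intro quot h)
    then show "P dvd h1 - \<alpha> * x * g"
      using dvd_add[OF _ dvd_mult[OF x, of \<alpha>]] by (fastforce simp: algebra_simps)
    have "\<beta> = (h2 * h3 * root_inv h5 mod P) * root_inv h6 mod P"
      unfolding \<beta> by (simp only: mod_mult_left_eq mod_mult_right_eq) (simp only: mult_ac)
    then have "P dvd h2 * h3 * root_inv h5 mod P - \<beta> * g"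
      using quot[OF h(6), of "h2 * h3 * root_inv h5 mod P"] e by simp
    then have "P dvd h5 * (h2 * h3 * root_inv h5 mod P - \<beta> * g) + (h2 * h3 - (h2 * h3 * root_inv h5 mod P) * h5)
        + \<beta> * g * (h5 - w * g)"
      using quot[OF h(5), of "h2 * h3"] w by (intro dvd_add dvd_mult)
    then show "P dvd h2 * h3 - \<beta> * w * g ^ 2"
      by (simp add: algebra_simps power2_eq_square)
  qed
  have "finite additive_sextuples"
    by (rule finite_subset[of _ "(roots \<times> roots \<times> roots) \<times> (roots \<times> roots \<times> roots)"])
      (auto simp: additive_sextuples_def)
  \<comment> \<open>\<open>h6\<close> is a free factor. The image under \<open>f\<close> determines
    \<open>h1\<close>, \<open>h4\<close>, \<open>h5\<close>, \<open>h6\<close> and the product of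
    \<open>h2\<close> and \<open>h3\<close>, whose sum follows from the first equation; so a fibre
    has at most two elements, which differ by a swap.\<close>
  then have "card additive_sextuples \<le> 2 * card (roots \<times> moebius_curve)"
  proof (rule card_le_mult_card_fibres[where f = f])
    show "finite (roots \<times> moebius_curve)" using finite_moebius_curve by simp
    show "f ` additive_sextuples \<subseteq> roots \<times> moebius_curve"
    proof
      fix y assume "y \<in> f ` additive_sextuples"
      then obtain q where "q \<in> additive_sextuples" "f q = y" by blast
      moreover obtain h1 h2 h3 h4 h5 h6 where "q = ((h1, h2, h3), (h4, h5, h6))" by (rule triple_pair_cases)
      moreover obtain g \<alpha> \<beta> x w where y: "y = (g, \<alpha>, \<beta>, x, w)" by (rule prod_cases5)
      ultimately have q: "((h1, h2, h3), (h4, h5, h6)) \<in> additive_sextuples"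
        and f: "f ((h1, h2, h3), (h4, h5, h6)) = (g, \<alpha>, \<beta>, x, w)" by auto
      note D = fD[OF q f]
      have h: "h1 \<in> roots" "h2 \<in> roots" "h3 \<in> roots" "h4 \<in> roots" "h5 \<in> roots" "h6 \<in> roots"
        and s: "P dvd h1 + h2 + h3 - (h4 + h5 + g)"
        and t: "P dvd root_inv h1 + root_inv h2 + root_inv h3 - (root_inv h4 + root_inv h5 + root_inv g)"
        using q D(5) by (auto simp: additive_sextuples_def cong_iff_dvd_diff)
      have "(\<alpha>, \<beta>, x, w) \<in> moebius_curve"
        unfolding moebius_curve_def cong_iff_dvd_diff
        using D moebius_curve_identity[OF D(1-4) s t inv inv inv inv inv inv] h by simp
      then show "y \<in> roots \<times> moebius_curve" using y D by simp
    qed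
    fix y assume "y \<in> roots \<times> moebius_curve"
    obtain g \<alpha> \<beta> x w where y: "y = (g, \<alpha>, \<beta>, x, w)" by (rule prod_cases5)
    let ?F = "{q \<in> additive_sextuples. f q = y}"
    show "card ?F \<le> 2"
    proof (cases "?F = {}")
      case False
      then obtain q0 where q0: "q0 \<in> ?F" by blast
      obtain h1 h2 h3 h4 h5 h6 where q0': "q0 = ((h1, h2, h3), (h4, h5, h6))" by (rule triple_pair_cases)
      have "?F \<subseteq> {q0, ((h1, h3, h2), (h4, h5, h6))}"
      proof
        fix q assume q: "q \<in> ?F"
        obtain l1 l2 l3 l4 l5 l6 where q': "q = ((l1, l2, l3), (l4, l5, l6))" by (rule triple_pair_cases)
        have A: "((h1, h2, h3), (h4, h5, h6)) \<in> additive_sextuples" "f ((h1, h2, h3), (h4, h5, h6)) = (g, \<alpha>, \<beta>, x, w)"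
          using q0 q0' y by auto
        have B: "((l1, l2, l3), (l4, l5, l6)) \<in> additive_sextuples" "f ((l1, l2, l3), (l4, l5, l6)) = (g, \<alpha>, \<beta>, x, w)"
          using q q' y by auto
        note D = fD[OF A] and E = fD[OF B]
        have h: "h1 \<in> roots" "h2 \<in> roots" "h3 \<in> roots" "h4 \<in> roots" "h5 \<in> roots" "h6 \<in> roots"
          and hs: "P dvd h1 + h2 + h3 - (h4 + h5 + h6)"
          using A(1) by (auto simp: additive_sextuples_def cong_iff_dvd_diff)
        have l: "l1 \<in> roots" "l2 \<in> roots" "l3 \<in> roots" "l4 \<in> roots" "l5 \<in> roots" "l6 \<in> roots"
          and ls: "P dvd l1 + l2 + l3 - (l4 + l5 + l6)"
          using B(1) by (auto simp: additive_sextuples_def cong_iff_dvd_diff)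
        have eq: "u = v" if "P dvd u - c" "P dvd v - c" "u \<in> roots" "v \<in> roots" for u v c
          using dvd_diff[OF that(1,2)] that by (simp add: roots_eq_iff)
        have e: "l1 = h1" "l4 = h4" "l5 = h5" "l6 = h6"
          using eq[OF E(1) D(1)] eq[OF E(2) D(2)] eq[OF E(3) D(3)] D(5) E(5) h l by auto
        have "[l2 * l3 = h2 * h3] (mod P)"
          using dvd_diff[OF E(4) D(4)] by (simp add: cong_iff_dvd_diff)
        moreover have "[l2 + l3 = h2 + h3] (mod P)"
          using dvd_diff[OF ls hs] e by (simp add: cong_iff_dvd_diff algebra_simps)
        ultimately have "(l2 = h2 \<and> l3 = h3) \<or> (l2 = h3 \<and> l3 = h2)"
          using sum_prod_mod_eq h l by blast
        then show "q \<in> {q0, ((h1, h3, h2), (h4, h5, h6))}" using e q' q0' by auto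
      qed
      then have "card ?F \<le> card {q0, ((h1, h3, h2), (h4, h5, h6))}" by (intro card_mono) auto
      also have "\<dots> \<le> 2" by (simp add: card_insert_if)
      finally show ?thesis .
    next
      case True
      then show ?thesis by (simp only: card.empty)
    qed
  qed
  also have "\<dots> = 2 * (card roots * card moebius_curve)" by (simp add: card_cartesian_product)
  finally have "real (card additive_sextuples) \<le> real (2 * (card roots * card moebius_curve))"
    by (simp only: of_nat_le_iff)
  also have "\<dots> = 2 * (real (card roots) * real (card moebius_curve))" by simp
  also have "\<dots> \<le> 2 * (real \<tau> * (20 * \<tau> powr (8/3)))"
    using card_roots_le card_moebius_curve[OF \<tau>P] by (intro mult_left_mono mult_mono) auto
  also have "\<dots> = 40 * (\<tau> powr 1 * \<tau> powr (8/3))" using \<tau> by simp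
  also have "\<dots> = 40 * \<tau> powr (11/3)" by (subst powr_add[symmetric]) simp
  finally show ?thesis .
qed

end

section \<open>Kloosterman sums over roots of unity\<close>

text \<open>Jensen's inequality for the convex function \<open>x ^ Suc n\<close> on the nonnegative
  reals; it is the form in which Hoelder's inequality is applied.\<close>

lemma power_sum_le:
  fixes x :: "'a \<Rightarrow> real"
  assumes "\<And>i. i \<in> I \<Longrightarrow> x i \<ge> 0"
  shows "(\<Sum>i\<in>I. x i) ^ Suc n \<le> real (card I) ^ n * (\<Sum>i\<in>I. x i ^ Suc n)"
proof (cases "finite I \<and> I \<noteq> {}")
  case True
  then have c: "real (card I) > 0" by (simp add: card_gt_0_iff)
  have "convex_on {0..} (\<lambda>x::real. x ^ Suc n)"
    using convex_power_odd[of "Suc n"] convex_on_subset[OF convex_power_even[of "Suc n"], of "{0..}"]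
    by (cases "even (Suc n)") auto
  then have "(\<Sum>i\<in>I. (1 / card I) *\<^sub>R x i) ^ Suc n \<le> (\<Sum>i\<in>I. (1 / card I) * x i ^ Suc n)"
    using True assms by (intro convex_on_sum[where C = "{0..}"]) auto
  then have "(\<Sum>i\<in>I. x i) ^ Suc n / card I ^ Suc n \<le> (\<Sum>i\<in>I. x i ^ Suc n) / card I"
    by (simp add: sum_divide_distrib[symmetric] power_divide del: power_Suc)
  then show ?thesis using c by (simp add: field_simps)
qed auto

section \<open>Energies and Cauchy-Schwarz\<close>

definition energy :: "int \<Rightarrow> 'z set \<Rightarrow> ('z \<Rightarrow> int) \<Rightarrow> ('z \<Rightarrow> int) \<Rightarrow> nat" where
  "energy P Z a b = card {(z, z'). z \<in> Z \<and> z' \<in> Z \<and> [a z = a z'] (mod P) \<and> [b z = b z'] (mod P)}"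

text \<open>After grouping \<open>Z\<close> by residues, Cauchy-Schwarz leaves the sum of the
  squared class sizes, which counts pairs with equal residues and so is the energy.\<close>

lemma sum_mod_le_energy:
  fixes F :: "int \<Rightarrow> int \<Rightarrow> real"
  assumes "finite Z" "P > 0"
  shows "(\<Sum>z\<in>Z. F (a z mod P) (b z mod P)) ^ 2 \<le>
    energy P Z a b * (\<Sum>(s, t)\<in>{0..<P} \<times> {0..<P}. F s t ^ 2)"
proof -
  let ?R = "{0..<P} \<times> {0..<P}"
  let ?r = "\<lambda>z. (a z mod P, b z mod P)"
  define J where "J y = {z \<in> Z. ?r z = y}" for y
  have finJ: "finite (J y)" for y using assms by (simp add: J_def)
  have r: "?r z \<in> ?R" for z using assms by simp
  have "(\<Sum>z\<in>Z. F (a z mod P) (b z mod P)) = (\<Sum>y\<in>?R. \<Sum>z\<in>J y. F (a z mod P) (b z mod P))"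
    unfolding J_def using r by (intro sum.group[symmetric] assms) auto
  also have "\<dots> = (\<Sum>y\<in>?R. real (card (J y)) * F (fst y) (snd y))"
    by (intro sum.cong refl) (auto simp: J_def)
  finally have "(\<Sum>z\<in>Z. F (a z mod P) (b z mod P)) ^ 2 \<le>
      (\<Sum>y\<in>?R. real (card (J y)) ^ 2) * (\<Sum>y\<in>?R. F (fst y) (snd y) ^ 2)"
    using Cauchy_Schwarz_ineq_sum[of "\<lambda>y. real (card (J y))" "\<lambda>y. F (fst y) (snd y)" ?R] by simp
  also have "(\<Sum>y\<in>?R. real (card (J y)) ^ 2) = real (\<Sum>y\<in>?R. card (J y \<times> J y))"
    by (simp add: card_cartesian_product power2_eq_square)
  also have "(\<Sum>y\<in>?R. card (J y \<times> J y)) = card (\<Union>y\<in>?R. J y \<times> J y)"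
    by (rule card_UN_disjoint[symmetric]) (auto simp: finJ, auto simp: J_def)
  also have "(\<Union>y\<in>?R. J y \<times> J y) = {(z, z'). z \<in> Z \<and> z' \<in> Z \<and> [a z = a z'] (mod P) \<and> [b z = b z'] (mod P)}"
    using assms(2) by (auto simp: J_def cong_def)
  finally show ?thesis by (simp add: energy_def case_prod_unfold)
qed

section \<open>Characters modulo a prime, pulled back to the integers\<close>

locale roots_of_unity_character = roots_of_unity_mod +
  fixes e :: "int \<Rightarrow> complex"
  assumes e_add: "e (x + y) = e x * e y" and norm_e [simp]: "norm (e x) = 1"
    and e_cong: "[x = y] (mod P) \<Longrightarrow> e x = e y" and e_nontrivial: "\<exists>x. e x \<noteq> 1"
begin

lemma e_0 [simp]: "e 0 = 1"
  using e_add[of 0 0] norm_e[of 0] by (metis add_0 mult_cancel_left1 norm_zero zero_neq_one)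

lemma e_uminus: "e (- x) = cnj (e x)"
proof -
  have "e x * e (- x) = 1" using e_add[of x "- x"] by simp
  moreover have "e x * cnj (e x) = 1" by (simp add: complex_norm_square[symmetric])
  ultimately show ?thesis by (metis mult_cancel_left mult_zero_left zero_neq_one)
qed

text \<open>Orthogonality: if \<open>e y \<noteq> 1\<close> and \<open>c\<close> is inverse to
  \<open>u * d\<close>, translating \<open>s\<close> by \<open>c * y\<close> multiplies the sum by
  \<open>e y\<close>, so the sum is 0.\<close>

lemma sum_character:
  assumes u: "\<not> P dvd u"
  shows "(\<Sum>s\<in>{0..<P}. e (u * s * d)) = (if P dvd d then of_int P else 0)"
proof (cases "P dvd d")
  case True
  have "e (u * s * d) = 1" for s
    using e_cong[of "u * s * d" 0] True by (simp add: cong_0_iff)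
  then show ?thesis using True P1 by simp
next
  case False
  obtain y where y: "e y \<noteq> 1" using e_nontrivial by blast
  have "\<not> P dvd u * d" using u False by (simp add: P_dvd_mult_iff)
  then have "coprime (u * d) P" using P by (metis prime_imp_coprime coprime_commute)
  then obtain c where c: "[u * d * c = 1] (mod P)" using cong_solve_coprime_int by blast
  have "(\<Sum>s\<in>{0..<P}. e (u * s * d)) = (\<Sum>s\<in>{0..<P}. e (u * ((s + c * y) mod P) * d))"
    by (rule sum.reindex_bij_witness[of _ "\<lambda>s. (s + c * y) mod P" "\<lambda>s. (s - c * y) mod P"])
      (use P1 in \<open>auto simp: mod_simps\<close>)
  also have "\<dots> = (\<Sum>s\<in>{0..<P}. e y * e (u * s * d))"
  proof (intro sum.cong refl)
    fix s
    have "[u * ((s + c * y) mod P) * d = u * (s + c * y) * d] (mod P)"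
      by (intro cong_mult cong_refl) simp
    also have "u * (s + c * y) * d = (u * d * c) * y + u * s * d" by (simp add: algebra_simps)
    also have "[\<dots> = 1 * y + u * s * d] (mod P)" by (intro cong_add cong_mult c cong_refl)
    finally have "e (u * ((s + c * y) mod P) * d) = e (y + u * s * d)" by (intro e_cong) simp
    then show "e (u * ((s + c * y) mod P) * d) = e y * e (u * s * d)" by (simp add: e_add)
  qed
  also have "\<dots> = e y * (\<Sum>s\<in>{0..<P}. e (u * s * d))" by (simp add: sum_distrib_left)
  finally show ?thesis using y False by simp
qed

text \<open>Parseval's identity. After expanding the square, orthogonality in \<open>s\<close> and
  in \<open>t\<close> keeps the pairs counted by the energy, each with weight \<open>P\<close> per
  variable.\<close>

lemma mean_square_energy:
  assumes Z: "finite Z" and u: "\<not> P dvd u" and v: "\<not> P dvd v"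
  shows "(\<Sum>(s, t)\<in>{0..<P} \<times> {0..<P}. norm (\<Sum>z\<in>Z. e (u * s * a z + v * t * b z)) ^ 2) =
    real_of_int P ^ 2 * energy P Z a b"
proof -
  let ?R = "{0..<P} \<times> {0..<P}"
  have "complex_of_real (\<Sum>(s, t)\<in>?R. norm (\<Sum>z\<in>Z. e (u * s * a z + v * t * b z)) ^ 2) =
    (\<Sum>(s, t)\<in>?R. \<Sum>(z, z')\<in>Z \<times> Z. e (u * s * (a z - a z')) * e (v * t * (b z - b z')))"
    unfolding of_real_sum
  proof (intro sum.cong refl, clarify)
    fix s t
    have "complex_of_real (norm (\<Sum>z\<in>Z. e (u * s * a z + v * t * b z)) ^ 2) =
      (\<Sum>z\<in>Z. e (u * s * a z + v * t * b z)) * (\<Sum>z'\<in>Z. e (- (u * s * a z' + v * t * b z')))"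
      by (simp only: complex_norm_square e_uminus cnj_sum)
    also have "\<dots> = (\<Sum>(z, z')\<in>Z \<times> Z. e (u * s * a z + v * t * b z) * e (- (u * s * a z' + v * t * b z')))"
      by (simp add: sum_product sum.cartesian_product)
    also have "\<dots> = (\<Sum>(z, z')\<in>Z \<times> Z. e (u * s * (a z - a z')) * e (v * t * (b z - b z')))"
      by (intro sum.cong refl) (auto simp: algebra_simps simp flip: e_add)
    finally show "complex_of_real (norm (\<Sum>z\<in>Z. e (u * s * a z + v * t * b z)) ^ 2) =
      (\<Sum>(z, z')\<in>Z \<times> Z. e (u * s * (a z - a z')) * e (v * t * (b z - b z')))" .
  qed
  also have "\<dots> = (\<Sum>(z, z')\<in>Z \<times> Z. \<Sum>(s, t)\<in>?R. e (u * s * (a z - a z')) * e (v * t * (b z - b z')))"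
    unfolding case_prod_unfold by (rule sum.swap)
  also have "\<dots> = (\<Sum>(z, z')\<in>Z \<times> Z. (\<Sum>s\<in>{0..<P}. e (u * s * (a z - a z'))) * (\<Sum>t\<in>{0..<P}. e (v * t * (b z - b z'))))"
    by (simp add: sum_product sum.cartesian_product)
  also have "\<dots> = (\<Sum>(z, z')\<in>Z \<times> Z. if [a z = a z'] (mod P) \<and> [b z = b z'] (mod P) then of_int P ^ 2 else 0)"
    unfolding sum_character[OF u] sum_character[OF v]
    by (intro sum.cong refl) (auto simp: cong_iff_dvd_diff power2_eq_square)
  also have "\<dots> = (\<Sum>(z, z')\<in>{(z, z'). z \<in> Z \<and> z' \<in> Z \<and> [a z = a z'] (mod P) \<and> [b z = b z'] (mod P)}. of_int P ^ 2)"
    using Z by (intro sum.mono_neutral_cong_right) (auto split: if_splits)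
  also have "\<dots> = complex_of_real (real_of_int P ^ 2 * energy P Z a b)"
    by (simp add: energy_def case_prod_unfold)
  finally show ?thesis by (simp only: of_real_eq_iff)
qed

section \<open>Symmetry and moments of Kloosterman sums\<close>

definition kloosterman :: "int \<Rightarrow> int \<Rightarrow> complex" where
  "kloosterman u v = (\<Sum>h\<in>roots. e (u * h + v * root_inv h))"

lemma kloosterman_mod [simp]: "kloosterman (u * (x mod P)) (v * (y mod P)) = kloosterman (u * x) (v * y)"
  unfolding kloosterman_def by (intro sum.cong refl e_cong cong_add cong_mult) auto

lemma root_inv_mult:
  assumes "g \<in> roots" "h \<in> roots"
  shows "[root_inv (g * h mod P) = root_inv g * root_inv h] (mod P)"
  by (simp add: root_inv_def cong_def power_mod mod_mult_eq power_mult_distrib)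

lemma kloosterman_shift:
  assumes g: "g \<in> roots"
  shows "kloosterman (u * g) (v * root_inv g) = kloosterman u v"
proof -
  have gi: "[g * root_inv g = 1] (mod P)" by (rule root_inv[OF g])
  have inj: "inj_on (\<lambda>h. g * h mod P) roots"
  proof (rule inj_onI)
    fix x y assume x: "x \<in> roots" and y: "y \<in> roots" and "g * x mod P = g * y mod P"
    then have "P dvd g * (x - y)" by (simp add: mod_eq_dvd_iff right_diff_distrib)
    then show "x = y" using x y roots_not_dvd[OF g] by (simp add: P_dvd_mult_iff roots_eq_iff)
  qed
  moreover have "(\<lambda>h. g * h mod P) ` roots \<subseteq> roots" using mult_in_roots g by auto
  ultimately have "bij_betw (\<lambda>h. g * h mod P) roots roots"
    by (simp add: bij_betw_def endo_inj_surj)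
  then have "kloosterman u v = (\<Sum>h\<in>roots. e (u * (g * h mod P) + v * root_inv (g * h mod P)))"
    unfolding kloosterman_def by (rule sum.reindex_bij_betw[symmetric])
  also have "\<dots> = kloosterman (u * g) (v * root_inv g)"
    unfolding kloosterman_def
  proof (intro sum.cong refl e_cong)
    fix h assume h: "h \<in> roots"
    have "[u * (g * h mod P) + v * root_inv (g * h mod P) = u * (g * h) + v * (root_inv g * root_inv h)] (mod P)"
      by (intro cong_add cong_mult cong_refl root_inv_mult g h) simp
    then show "[u * (g * h mod P) + v * root_inv (g * h mod P) = u * g * h + v * root_inv g * root_inv h] (mod P)"
      by (simp add: mult.assoc)
  qed
  finally show ?thesis by simp
qed

text \<open>Averaging the \<open>k\<close>-th power over the shifts by \<open>g\<close> and
  exchanging sums turns each sum over \<open>g\<close> into another Kloosterman sum, with parameters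
  \<open>u * a z\<close> and \<open>v * b z\<close>. Hoelder raises these to the power
  \<open>Suc l\<close>, Cauchy-Schwarz spreads them over all pairs of residues at the price of the
  energy of \<open>Z\<close>, and the complete mean square is \<open>P ^ 2\<close> times the energy
  of \<open>Z'\<close>. The exponent \<open>l\<close> of the overview is \<open>Suc l\<close>
  here.\<close>

lemma kloosterman_power_bound:
  assumes Z: "finite Z" and Z': "finite Z'"
    and k: "\<And>u v. kloosterman u v ^ k = (\<Sum>z\<in>Z. e (u * a z + v * b z))"
    and l: "\<And>u v. kloosterman u v ^ Suc l = (\<Sum>z\<in>Z'. e (u * a' z + v * b' z))"
    and u: "\<not> P dvd u" and v: "\<not> P dvd v"
  shows "(real (card roots) * norm (kloosterman u v) ^ k) ^ (2 * Suc l) \<le>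
    real (card Z) ^ (2 * l) * energy P Z a b * energy P Z' a' b' * real_of_int P ^ 2"
proof -
  let ?F = "\<lambda>s t. norm (kloosterman (u * s) (v * t))"
  have P0: "P > 0" using P1 by simp
  have "of_nat (card roots) * kloosterman u v ^ k = (\<Sum>g\<in>roots. kloosterman (u * g) (v * root_inv g) ^ k)"
    by (simp add: kloosterman_shift)
  also have "\<dots> = (\<Sum>z\<in>Z. \<Sum>g\<in>roots. e (u * g * a z + v * root_inv g * b z))"
    unfolding k by (rule sum.swap)
  also have "\<dots> = (\<Sum>z\<in>Z. kloosterman (u * a z) (v * b z))"
    unfolding kloosterman_def by (simp add: mult_ac)
  finally have "norm (of_nat (card roots) * kloosterman u v ^ k) \<le> (\<Sum>z\<in>Z. ?F (a z) (b z))"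
    by (simp only: norm_sum)
  then have "real (card roots) * norm (kloosterman u v) ^ k \<le> (\<Sum>z\<in>Z. ?F (a z) (b z))"
    by (simp add: norm_mult norm_power)
  then have "(real (card roots) * norm (kloosterman u v) ^ k) ^ Suc l \<le> (\<Sum>z\<in>Z. ?F (a z) (b z)) ^ Suc l"
    by (intro power_mono) auto
  also have "\<dots> \<le> real (card Z) ^ l * (\<Sum>z\<in>Z. ?F (a z) (b z) ^ Suc l)"
    by (rule power_sum_le) simp
  finally have "((real (card roots) * norm (kloosterman u v) ^ k) ^ Suc l) ^ 2 \<le>
      (real (card Z) ^ l * (\<Sum>z\<in>Z. ?F (a z) (b z) ^ Suc l)) ^ 2"
    by (intro power_mono) auto
  also have "\<dots> = real (card Z) ^ (2 * l) * (\<Sum>z\<in>Z. ?F (a z mod P) (b z mod P) ^ Suc l) ^ 2"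
    by (simp add: power_mult_distrib mult.commute flip: power_mult del: power_Suc)
  also have "\<dots> \<le> real (card Z) ^ (2 * l) * (energy P Z a b *
      (\<Sum>(s, t)\<in>{0..<P} \<times> {0..<P}. (?F s t ^ Suc l) ^ 2))"
    by (intro mult_left_mono sum_mod_le_energy[OF Z P0, of "\<lambda>s t. ?F s t ^ Suc l"]) simp
  also have "(\<Sum>(s, t)\<in>{0..<P} \<times> {0..<P}. (?F s t ^ Suc l) ^ 2) = real_of_int P ^ 2 * energy P Z' a' b'"
    unfolding mean_square_energy[OF Z' u v, symmetric] norm_power[symmetric] l ..
  finally show ?thesis by (simp add: mult_ac flip: power_mult del: power_Suc)
qed

section \<open>Numerical bounds from second and third powers\<close>

definition "sum2 f = (\<lambda>(h1, h2). f h1 + f h2)" for f :: "int \<Rightarrow> int"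
definition "sum3 f = (\<lambda>(h1, h2, h3). f h1 + f h2 + f h3)" for f :: "int \<Rightarrow> int"

lemma kloosterman_power2: "kloosterman u v ^ Suc 1 = (\<Sum>z\<in>roots \<times> roots. e (u * sum2 (\<lambda>h. h) z + v * sum2 root_inv z))"
proof -
  have "kloosterman u v ^ Suc 1 = kloosterman u v * kloosterman u v" by simp
  also have "\<dots> = (\<Sum>z\<in>roots \<times> roots. e (u * sum2 (\<lambda>h. h) z + v * sum2 root_inv z))"
    unfolding kloosterman_def sum_product sum.cartesian_product
    by (intro sum.cong refl) (auto simp: sum2_def algebra_simps simp flip: e_add)
  finally show ?thesis .
qed

lemma kloosterman_power3: "kloosterman u v ^ Suc 2 = (\<Sum>z\<in>roots \<times> roots \<times> roots. e (u * sum3 (\<lambda>h. h) z + v * sum3 root_inv z))"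
proof -
  have "kloosterman u v ^ Suc 2 = kloosterman u v * (kloosterman u v * kloosterman u v)" by (simp add: numeral_2_eq_2)
  also have "\<dots> = (\<Sum>z\<in>roots \<times> roots \<times> roots. e (u * sum3 (\<lambda>h. h) z + v * sum3 root_inv z))"
    unfolding kloosterman_def sum_product sum.cartesian_product
    by (intro sum.cong refl) (auto simp: sum3_def algebra_simps simp flip: e_add)
  finally show ?thesis .
qed

lemma energy2: "energy P (roots \<times> roots) (sum2 (\<lambda>h. h)) (sum2 root_inv) = card additive_quadruples"
  unfolding energy_def additive_quadruples_def sum2_def by (intro arg_cong[of _ _ card]) auto

lemma energy3: "energy P (roots \<times> roots \<times> roots) (sum3 (\<lambda>h. h)) (sum3 root_inv) = card additive_sextuples"
  unfolding energy_def additive_sextuples_def sum3_def by (intro arg_cong[of _ _ card]) auto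

lemma norm_kloosterman_le_22:
  assumes card: "card roots = \<tau>" and u: "\<not> P dvd u" and v: "\<not> P dvd v"
  shows "norm (kloosterman u v) \<le> 2 * (\<tau> powr (1/2) * real_of_int P powr (1/4))"
proof (rule power_le_imp_le_base)
  have P0: "real_of_int P > 0" using P1 by simp
  have "card additive_quadruples \<le> 3 * \<tau> ^ 2" by (rule card_additive_quadruples)
  then have E: "real (card additive_quadruples) \<le> 3 * real \<tau> ^ 2" by (simp flip: of_nat_power of_nat_mult)
  have "(real \<tau> * norm (kloosterman u v) ^ Suc 1) ^ (2 * Suc 1) \<le>
      real (card (roots \<times> roots)) ^ (2 * 1) * card additive_quadruples * card additive_quadruples * real_of_int P ^ 2"
    using kloosterman_power_bound[OF _ _ kloosterman_power2 kloosterman_power2 u v] by (simp add: energy2 card)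
  also have "\<dots> \<le> real (card (roots \<times> roots)) ^ (2 * 1) * (3 * real \<tau> ^ 2) * (3 * real \<tau> ^ 2) * real_of_int P ^ 2"
    by (intro mult_mono mult_nonneg_nonneg E order_refl) auto
  finally have "real \<tau> ^ 4 * norm (kloosterman u v) ^ 8 \<le> real \<tau> ^ 4 * (9 * real \<tau> ^ 4 * real_of_int P ^ 2)"
    by (simp add: card_cartesian_product card power_mult_distrib eval_nat_numeral mult_ac)
  then have "norm (kloosterman u v) ^ 8 \<le> 9 * real \<tau> ^ 4 * real_of_int P ^ 2"
    using \<tau> by simp
  also have "\<dots> \<le> 256 * real \<tau> ^ 4 * real_of_int P ^ 2" by (intro mult_right_mono) auto
  also have "\<dots> = (2 * (\<tau> powr (1/2) * real_of_int P powr (1/4))) ^ Suc 7"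
    using \<tau> P0 by (simp add: power_mult_distrib powr_power del: power_Suc)
  finally show "norm (kloosterman u v) ^ Suc 7 \<le> (2 * (\<tau> powr (1/2) * real_of_int P powr (1/4))) ^ Suc 7" by simp
qed simp

text \<open>The moment bound reads \<open>\<tau>^4 |S|^12 \<le> \<tau>^6 * 40 \<tau>^(11/3) * 3
  \<tau>^2 * P^2\<close>, hence \<open>|S|^12 \<le> 120 \<tau>^(23/3) P^2\<close>, and
  \<open>120 < 2^12 = 4096\<close>.\<close>

lemma norm_kloosterman_le_32:
  assumes card: "card roots = \<tau>" and u: "\<not> P dvd u" and v: "\<not> P dvd v" and \<tau>P: "int \<tau> ^ 4 \<le> P ^ 3"
  shows "norm (kloosterman u v) \<le> 2 * (\<tau> powr (23/36) * real_of_int P powr (1/6))"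
proof (rule power_le_imp_le_base)
  have P0: "real_of_int P > 0" using P1 by simp
  have "card additive_quadruples \<le> 3 * \<tau> ^ 2" by (rule card_additive_quadruples)
  then have E2: "real (card additive_quadruples) \<le> 3 * real \<tau> ^ 2" by (simp flip: of_nat_power of_nat_mult)
  note E3 = card_additive_sextuples[OF \<tau>P]
  have "(real \<tau> * norm (kloosterman u v) ^ Suc 2) ^ (2 * Suc 1) \<le>
      real (card (roots \<times> roots \<times> roots)) ^ (2 * 1) * card additive_sextuples * card additive_quadruples * real_of_int P ^ 2"
    using kloosterman_power_bound[OF _ _ kloosterman_power3 kloosterman_power2 u v] by (simp add: energy2 energy3 card)
  also have "\<dots> \<le> real (card (roots \<times> roots \<times> roots)) ^ (2 * 1) * (40 * \<tau> powr (11/3)) * (3 * real \<tau> ^ 2) * real_of_int P ^ 2"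
    by (intro mult_mono mult_nonneg_nonneg E2 E3 order_refl) auto
  finally have "real \<tau> ^ 4 * norm (kloosterman u v) ^ 12 \<le> real \<tau> ^ 4 * (120 * real \<tau> ^ 4 * \<tau> powr (11/3) * real_of_int P ^ 2)"
    by (simp add: card_cartesian_product card power_mult_distrib eval_nat_numeral mult_ac)
  then have "norm (kloosterman u v) ^ 12 \<le> 120 * real \<tau> ^ 4 * \<tau> powr (11/3) * real_of_int P ^ 2"
    using \<tau> by simp
  also have "\<dots> \<le> 4096 * real \<tau> ^ 4 * \<tau> powr (11/3) * real_of_int P ^ 2" by (intro mult_right_mono) auto
  also have "\<dots> = 4096 * (\<tau> powr 4 * \<tau> powr (11/3)) * real_of_int P ^ 2" using \<tau> by simp
  also have "\<tau> powr 4 * \<tau> powr (11/3) = \<tau> powr (23/3)" by (subst powr_add[symmetric]) simp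
  also have "4096 * \<tau> powr (23/3) * real_of_int P ^ 2 = (2 * (\<tau> powr (23/36) * real_of_int P powr (1/6))) ^ Suc 11"
    using \<tau> P0 by (simp add: power_mult_distrib powr_power del: power_Suc)
  finally show "norm (kloosterman u v) ^ Suc 11 \<le> (2 * (\<tau> powr (23/36) * real_of_int P powr (1/6))) ^ Suc 11" by simp
qed simp

text \<open>The moment bound reads
  \<open>\<tau>^6 |S|^18 \<le> \<tau>^12 * (40 \<tau>^(11/3))^2 * P^2\<close>, hence
  \<open>|S|^18 \<le> 1600 \<tau>^(40/3) P^2\<close>, and
  \<open>1600 < 2^18 = 262144\<close>.\<close>

lemma norm_kloosterman_le_33:
  assumes card: "card roots = \<tau>" and u: "\<not> P dvd u" and v: "\<not> P dvd v" and \<tau>P: "int \<tau> ^ 4 \<le> P ^ 3"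
  shows "norm (kloosterman u v) \<le> 2 * (\<tau> powr (20/27) * real_of_int P powr (1/9))"
proof (rule power_le_imp_le_base)
  have P0: "real_of_int P > 0" using P1 by simp
  note E3 = card_additive_sextuples[OF \<tau>P]
  have "(real \<tau> * norm (kloosterman u v) ^ Suc 2) ^ (2 * Suc 2) \<le>
      real (card (roots \<times> roots \<times> roots)) ^ (2 * 2) * card additive_sextuples * card additive_sextuples * real_of_int P ^ 2"
    using kloosterman_power_bound[OF _ _ kloosterman_power3 kloosterman_power3 u v] by (simp add: energy3 card)
  also have "\<dots> \<le> real (card (roots \<times> roots \<times> roots)) ^ (2 * 2) * (40 * \<tau> powr (11/3)) * (40 * \<tau> powr (11/3)) * real_of_int P ^ 2"
    by (intro mult_mono mult_nonneg_nonneg E3 order_refl) auto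
  finally have "real \<tau> ^ 6 * norm (kloosterman u v) ^ 18 \<le> real \<tau> ^ 6 * (1600 * real \<tau> ^ 6 * (\<tau> powr (11/3) * \<tau> powr (11/3)) * real_of_int P ^ 2)"
    by (simp add: card_cartesian_product card power_mult_distrib eval_nat_numeral mult_ac)
  then have "norm (kloosterman u v) ^ 18 \<le> 1600 * real \<tau> ^ 6 * (\<tau> powr (11/3) * \<tau> powr (11/3)) * real_of_int P ^ 2"
    using \<tau> by simp
  also have "\<dots> \<le> 262144 * real \<tau> ^ 6 * (\<tau> powr (11/3) * \<tau> powr (11/3)) * real_of_int P ^ 2" by (intro mult_right_mono) auto
  also have "\<dots> = 262144 * (\<tau> powr 6 * (\<tau> powr (11/3) * \<tau> powr (11/3))) * real_of_int P ^ 2" using \<tau> by simp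
  also have "\<tau> powr 6 * (\<tau> powr (11/3) * \<tau> powr (11/3)) = \<tau> powr (40/3)"
    by (subst powr_add[symmetric])+ simp
  also have "262144 * \<tau> powr (40/3) * real_of_int P ^ 2 = (2 * (\<tau> powr (20/27) * real_of_int P powr (1/9))) ^ Suc 17"
    using \<tau> P0 by (simp add: power_mult_distrib powr_power del: power_Suc)
  finally show "norm (kloosterman u v) ^ Suc 17 \<le> (2 * (\<tau> powr (20/27) * real_of_int P powr (1/9))) ^ Suc 17" by simp
qed simp

theorem norm_kloosterman_le:
  assumes card: "card roots = \<tau>" and u: "\<not> P dvd u" and v: "\<not> P dvd v"
  shows "norm (kloosterman u v) \<le> 2 * min (\<tau> powr (23/36) * real_of_int P powr (1/6))
      (\<tau> powr (20/27) * real_of_int P powr (1/9))"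
proof (cases "int \<tau> ^ 4 \<le> P ^ 3")
  case True
  then show ?thesis using norm_kloosterman_le_32 norm_kloosterman_le_33 assms by (simp add: min_def)
next
  case False
  let ?p = "real_of_int P"
  have P0: "?p > 0" using P1 by simp
  have \<tau>1: "real \<tau> \<ge> 1" using \<tau> by simp
  \<comment> \<open>Now \<open>P \<le> \<tau>^(4/3)\<close>, so part of \<open>P^(1/4)\<close> can
    be traded for a power of \<open>\<tau>\<close>: \<open>P^(1/12)\<close> costs
    \<open>\<tau>^(1/9)\<close> and \<open>P^(5/36)\<close> costs \<open>\<tau>^(5/27)\<close>. The
    resulting exponents 11/18 and 37/54 lie below 23/36 and 20/27.\<close>
  have "real_of_int (P ^ 3) \<le> real_of_int (int \<tau> ^ 4)" using False by (simp only: of_int_le_iff)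
  then have "?p ^ 3 \<le> real \<tau> ^ 4" by simp
  then have "(?p ^ 3) powr (1/3) \<le> (real \<tau> ^ 4) powr (1/3)" using P0 by (intro powr_mono2) auto
  also have "(?p ^ 3) powr (1/3) = (?p powr 3) powr (1/3)" using P0 by simp
  also have "\<dots> = ?p" using P0 by (simp only: powr_powr) simp
  also have "(real \<tau> ^ 4) powr (1/3) = (real \<tau> powr 4) powr (1/3)" using \<tau> by simp
  also have "\<dots> = \<tau> powr (4/3)" by (simp only: powr_powr) simp
  finally have p: "?p \<le> \<tau> powr (4/3)" .
  have p_le: "?p powr r \<le> \<tau> powr (4/3 * r)" if "r \<ge> 0" for r
    using powr_mono2[OF that _ p] P0 by (simp add: powr_powr)
  have "\<tau> powr (1/2) * ?p powr (1/4) = \<tau> powr (1/2) * ?p powr (1/12) * ?p powr (1/6)"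
    by (simp add: mult.assoc flip: powr_add)
  also have "\<dots> \<le> \<tau> powr (1/2) * \<tau> powr (4/3 * (1/12)) * ?p powr (1/6)"
    by (intro mult_right_mono mult_left_mono p_le) auto
  also have "\<dots> = \<tau> powr (11/18) * ?p powr (1/6)" by (simp flip: powr_add)
  also have "\<dots> \<le> \<tau> powr (23/36) * ?p powr (1/6)"
    using \<tau>1 by (intro mult_right_mono powr_mono) auto
  finally have 1: "\<tau> powr (1/2) * ?p powr (1/4) \<le> \<tau> powr (23/36) * ?p powr (1/6)" .
  have "\<tau> powr (1/2) * ?p powr (1/4) = \<tau> powr (1/2) * ?p powr (5/36) * ?p powr (1/9)"
    by (simp add: mult.assoc flip: powr_add)
  also have "\<dots> \<le> \<tau> powr (1/2) * \<tau> powr (4/3 * (5/36)) * ?p powr (1/9)"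
    by (intro mult_right_mono mult_left_mono p_le) auto
  also have "\<dots> = \<tau> powr (37/54) * ?p powr (1/9)" by (simp flip: powr_add)
  also have "\<dots> \<le> \<tau> powr (20/27) * ?p powr (1/9)"
    using \<tau>1 by (intro mult_right_mono powr_mono) auto
  finally have 2: "\<tau> powr (1/2) * ?p powr (1/4) \<le> \<tau> powr (20/27) * ?p powr (1/9)" .
  show ?thesis using norm_kloosterman_le_22[OF assms] 1 2 by (simp add: min_def)
qed

end

section \<open>Reduction to Kloosterman sums\<close>

lemma residue_ring_simps [simp]:
  "carrier (residue_ring m) = {0..m - 1}"
  "x \<otimes>\<^bsub>residue_ring m\<^esub> y = x * y mod m"
  "x \<oplus>\<^bsub>residue_ring m\<^esub> y = (x + y) mod m"
  "\<zero>\<^bsub>residue_ring m\<^esub> = 0"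
  "\<one>\<^bsub>residue_ring m\<^esub> = 1"
  by (simp_all add: residue_ring_def)

text \<open>The representatives on the right are arbitrary, so that unreduced integer expressions
  can be substituted for the entries.\<close>

lemma dot2_residue_cong:
  assumes "[u $ 1 = u1] (mod P)" "[u $ 2 = u2] (mod P)" "[v $ 1 = v1] (mod P)" "[v $ 2 = v2] (mod P)"
  shows "[dot2 (residue_ring P) u v = u1 * v1 + u2 * v2] (mod P)"
  using cong_add[OF cong_mult[OF assms(1,3)] cong_mult[OF assms(2,4)]]
  by (simp add: dot2_def cong_def mod_simps)

lemma row_mult_residue_cong:
  assumes "[A $ 1 $ j = a1] (mod P)" "[A $ 2 $ j = a2] (mod P)"
  shows "[row_mult (residue_ring P) u A $ j = u $ 1 * a1 + u $ 2 * a2] (mod P)"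
  unfolding row_mult_def using dot2_residue_cong[of u _ P _ "\<chi> i. A $ i $ j" a1 a2] assms by simp

lemma mult_col_residue_cong:
  assumes "[A $ i $ 1 = a1] (mod P)" "[A $ i $ 2 = a2] (mod P)"
  shows "[mult_col (residue_ring P) A v $ i = a1 * v $ 1 + a2 * v $ 2] (mod P)"
  unfolding mult_col_def using dot2_residue_cong[of "A $ i" a1 P a2 v] assms by simp

lemma mat2_mult_residue_cong:
  assumes "[A $ i $ 1 = a1] (mod P)" "[A $ i $ 2 = a2] (mod P)" "[B $ 1 $ j = b1] (mod P)" "[B $ 2 $ j = b2] (mod P)"
  shows "[mat2_mult (residue_ring P) A B $ i $ j = a1 * b1 + a2 * b2] (mod P)"
  unfolding mat2_mult_def row_mult_def using dot2_residue_cong[of "A $ i" a1 P a2 "\<chi> i. B $ i $ j" b1 b2] assms by simp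

text \<open>A relation \<open>w = c u\<close> would be a linear dependence with coefficients
  \<open>- c mod P\<close> and 1.\<close>

lemma lin_indep2_residue:
  assumes "lin_indep2 (residue_ring P) u w" "P > 1"
  shows "\<not> (P dvd w $ 1 - c * u $ 1 \<and> P dvd w $ 2 - c * u $ 2)"
proof
  assume d: "P dvd w $ 1 - c * u $ 1 \<and> P dvd w $ 2 - c * u $ 2"
  have "((- c mod P) * u $ i mod P + 1 * w $ i mod P) mod P = 0" for i
  proof -
    have "P dvd w $ i - c * u $ i" using d exhaust_2[of i] by auto
    then show ?thesis by (simp add: mod_simps mod_0_imp_dvd dvd_imp_mod_0)
  qed
  moreover have "- c mod P \<in> carrier (residue_ring P)" "1 \<in> carrier (residue_ring P)"
    using assms(2) by auto
  ultimately have "(1::int) = 0"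
    using assms(1)[unfolded lin_indep2_def, THEN bspec, THEN bspec, of "- c mod P" 1] by simp
  then show False by simp
qed

context residues
begin

lemma SL2_pow_in_range:
  assumes "A \<in> carrier (SL2 R)"
  shows "(A [^]\<^bsub>SL2 R\<^esub> (n::nat)) $ i $ j \<in> {0..<m}"
proof -
  interpret G: group "SL2 R" by (rule group_SL2)
  have "A [^]\<^bsub>SL2 R\<^esub> n \<in> carrier (SL2 R)" using assms by simp
  then have "(A [^]\<^bsub>SL2 R\<^esub> n) $ i $ j \<in> carrier R" by (auto simp: SL2_def mat2_def)
  then show ?thesis by (auto simp: res_carrier_eq)
qed

end

lemma norm_expsum2_le:
  fixes p :: nat and \<psi> :: "int \<Rightarrow> complex" and a b :: "int^2" and A :: "int^2^2"
  defines "F \<equiv> residue_ring (int p)"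
  defines "\<tau> \<equiv> mult_order (SL2 F) A"
  assumes p: "prime p" and \<psi>: "nontrivial_character F \<psi>"
    and A: "A \<in> carrier (SL2 F)" and diag: "diagonalisable2 F A l m"
    and a: "lin_indep2 F a (row_mult F a A)" and b: "lin_indep2 F b (mult_col F A b)"
  shows "norm (expsum2 F \<psi> a b A) \<le> 2 * min (real \<tau> powr (23/36) * real p powr (1/6))
             (real \<tau> powr (20/27) * real p powr (1/9))"
proof -
  define P where "P = int p"
  have FP: "F = residue_ring P" by (simp add: F_def P_def)
  have primeP: "prime P" using p by (simp add: P_def)
  then have P1: "P > 1" by (rule prime_gt_1_int)
  interpret R: residues P F by unfold_locales (simp_all add: P1 FP)
  interpret G: group "SL2 F" by (rule R.group_SL2)
  obtain V W where VW: "mat2_mult F V W = mat2_one F" and WV: "mat2_mult F W V = mat2_one F"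
    and Adiag: "A = mat2_mult F (mat2_mult F V (diag2 F l m)) W"
    using diag unfolding diagonalisable2_def by blast
  \<comment> \<open>Entry \<open>(i, j)\<close> of \<open>V diag(l^x, m^x) W\<close> over the
    integers, unreduced; modulo \<open>P\<close> it is the entry of \<open>A^x\<close>.\<close>
  define M where "M x i j = V $ i $ 1 * l ^ x * W $ 1 $ j + V $ i $ 2 * m ^ x * W $ 2 $ j" for x :: nat and i j :: 2
  have one: "mat2_one F $ i $ j = (if i = j then 1 else 0)" for i j :: 2
    using exhaust_2[of i] exhaust_2[of j] by (auto simp: mat2_one_def diag2_def FP)
  have VW': "[V $ i $ 1 * W $ 1 $ j + V $ i $ 2 * W $ 2 $ j = (if i = j then 1 else 0)] (mod P)" for i j :: 2
    using mat2_mult_residue_cong[of V i "V $ i $ 1" P "V $ i $ 2" W j "W $ 1 $ j" "W $ 2 $ j"]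
    by (simp add: VW[unfolded FP] one[unfolded FP] cong_sym_eq)
  have WV': "[W $ i $ 1 * V $ 1 $ j + W $ i $ 2 * V $ 2 $ j = (if i = j then 1 else 0)] (mod P)" for i j :: 2
    using mat2_mult_residue_cong[of W i "W $ i $ 1" P "W $ i $ 2" V j "V $ 1 $ j" "V $ 2 $ j"]
    by (simp add: WV[unfolded FP] one[unfolded FP] cong_sym_eq)
  have AM: "[A $ i $ j = M 1 i j] (mod P)" for i j :: 2
  proof -
    have D: "diag2 F l m $ 1 $ 1 = l" "diag2 F l m $ 1 $ 2 = 0" "diag2 F l m $ 2 $ 1 = 0" "diag2 F l m $ 2 $ 2 = m"
      by (simp_all add: diag2_def FP)
    have "[mat2_mult F V (diag2 F l m) $ i $ 1 = V $ i $ 1 * l + V $ i $ 2 * 0] (mod P)"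
      "[mat2_mult F V (diag2 F l m) $ i $ 2 = V $ i $ 1 * 0 + V $ i $ 2 * m] (mod P)"
      unfolding FP by (rule mat2_mult_residue_cong; simp add: D[unfolded FP])+
    then have "[A $ i $ j = (V $ i $ 1 * l + V $ i $ 2 * 0) * W $ 1 $ j + (V $ i $ 1 * 0 + V $ i $ 2 * m) * W $ 2 $ j] (mod P)"
      unfolding Adiag FP by (rule mat2_mult_residue_cong) simp_all
    then show ?thesis by (simp add: M_def)
  qed
  have powM: "[(A [^]\<^bsub>SL2 F\<^esub> x) $ i $ j = M x i j] (mod P)" for x :: nat and i j :: 2
  proof (induction x arbitrary: i j)
    case 0
    have "A [^]\<^bsub>SL2 F\<^esub> (0::nat) = mat2_one F" by (simp add: SL2_def nat_pow_def)
    then show ?case using VW'[of i j] by (simp add: one M_def cong_sym)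
  next
    case (Suc x)
    have "A [^]\<^bsub>SL2 F\<^esub> Suc x = mat2_mult F (A [^]\<^bsub>SL2 F\<^esub> x) A" by (simp add: SL2_def)
    then have "[(A [^]\<^bsub>SL2 F\<^esub> Suc x) $ i $ j = M x i 1 * M 1 1 j + M x i 2 * M 1 2 j] (mod P)"
      unfolding FP by (simp only:) (rule mat2_mult_residue_cong[OF Suc[unfolded FP] Suc[unfolded FP] AM AM])
    also have "M x i 1 * M 1 1 j + M x i 2 * M 1 2 j =
      V $ i $ 1 * l ^ x * l * W $ 1 $ j * (W $ 1 $ 1 * V $ 1 $ 1 + W $ 1 $ 2 * V $ 2 $ 1)
      + V $ i $ 1 * l ^ x * m * W $ 2 $ j * (W $ 1 $ 1 * V $ 1 $ 2 + W $ 1 $ 2 * V $ 2 $ 2)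
      + V $ i $ 2 * m ^ x * l * W $ 1 $ j * (W $ 2 $ 1 * V $ 1 $ 1 + W $ 2 $ 2 * V $ 2 $ 1)
      + V $ i $ 2 * m ^ x * m * W $ 2 $ j * (W $ 2 $ 1 * V $ 1 $ 2 + W $ 2 $ 2 * V $ 2 $ 2)"
      by (simp add: M_def algebra_simps)
    also have "[\<dots> = V $ i $ 1 * l ^ x * l * W $ 1 $ j * 1 + V $ i $ 1 * l ^ x * m * W $ 2 $ j * 0
      + V $ i $ 2 * m ^ x * l * W $ 1 $ j * 0 + V $ i $ 2 * m ^ x * m * W $ 2 $ j * 1] (mod P)"
      using WV'[of 1 1] WV'[of 1 2] WV'[of 2 1] WV'[of 2 2] by (intro cong_add cong_mult cong_refl) simp_all
    finally show ?case by (simp add: M_def mult_ac)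
  qed
  \<comment> \<open>The determinant of \<open>A\<close> is \<open>l * m\<close>. So
    \<open>m ^ x\<close> is inverse to \<open>l ^ x\<close>, which turns the sum into a Kloosterman
    sum.\<close>
  have lm: "[l * m = 1] (mod P)"
  proof -
    have "A $ 1 $ 1 \<otimes>\<^bsub>F\<^esub> A $ 2 $ 2 \<ominus>\<^bsub>F\<^esub> A $ 1 $ 2 \<otimes>\<^bsub>F\<^esub> A $ 2 $ 1 = 1"
      using A by (simp add: SL2_def det2_def FP)
    moreover have "A $ 1 $ 2 \<otimes>\<^bsub>F\<^esub> A $ 2 $ 1 \<in> carrier F" using P1 by (simp add: FP)
    moreover have "A $ 1 $ 1 \<otimes>\<^bsub>F\<^esub> A $ 2 $ 2 \<in> carrier F" using P1 by (simp add: FP)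
    moreover have "x = x \<ominus>\<^bsub>F\<^esub> y \<oplus>\<^bsub>F\<^esub> y" if "x \<in> carrier F" "y \<in> carrier F" for x y
      using that by (simp add: R.minus_eq R.a_assoc R.l_neg)
    ultimately have "A $ 1 $ 1 \<otimes>\<^bsub>F\<^esub> A $ 2 $ 2 = 1 \<oplus>\<^bsub>F\<^esub> A $ 1 $ 2 \<otimes>\<^bsub>F\<^esub> A $ 2 $ 1"
      by metis
    then have "[A $ 1 $ 1 * A $ 2 $ 2 = 1 + A $ 1 $ 2 * A $ 2 $ 1] (mod P)"
      by (simp add: FP cong_def mod_simps)
    moreover have "[A $ 1 $ 1 * A $ 2 $ 2 = M 1 1 1 * M 1 2 2] (mod P)" by (intro cong_mult AM)
    moreover have "[1 + A $ 1 $ 2 * A $ 2 $ 1 = 1 + M 1 1 2 * M 1 2 1] (mod P)" by (intro cong_add cong_mult AM cong_refl)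
    ultimately have "[M 1 1 1 * M 1 2 2 = 1 + M 1 1 2 * M 1 2 1] (mod P)" by (simp add: cong_def)
    then have 1: "P dvd M 1 1 1 * M 1 2 2 - (1 + M 1 1 2 * M 1 2 1)" by (simp add: cong_iff_dvd_diff)
    \<comment> \<open>Multiplicativity of the determinant: that of \<open>M 1\<close> is
      \<open>l * m\<close> times that of \<open>M 0\<close>, and \<open>M 0\<close> is
      \<open>V W\<close>, the identity modulo \<open>P\<close>.\<close>
    have 2: "M 1 1 1 * M 1 2 2 - (1 + M 1 1 2 * M 1 2 1) =
      l * m * (M 0 1 1 * M 0 2 2 - M 0 1 2 * M 0 2 1 - 1) + (l * m - 1)"
      by (simp add: M_def algebra_simps)
    have "[M 0 1 1 * M 0 2 2 - M 0 1 2 * M 0 2 1 - 1 = 1 * 1 - 0 * 0 - 1] (mod P)"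
      using VW'[of 1 1] VW'[of 1 2] VW'[of 2 1] VW'[of 2 2]
      unfolding M_def by (intro cong_diff cong_mult cong_refl) simp_all
    then have "P dvd l * m * (M 0 1 1 * M 0 2 2 - M 0 1 2 * M 0 2 1 - 1)" by (simp add: cong_0_iff)
    then show ?thesis using 1 unfolding 2 by (simp add: dvd_add_right_iff cong_iff_dvd_diff)
  qed
  have lm_pow: "[l ^ x * m ^ x = 1] (mod P)" for x using cong_pow[OF lm, of x] by (simp add: power_mult_distrib)
  have not_dvd_l: "\<not> P dvd l"
  proof
    assume "P dvd l"
    then have "P dvd 1" using cong_dvd_iff[OF lm] by simp
    then show False using P1 by simp
  qed
  have pow_one_iff: "A [^]\<^bsub>SL2 F\<^esub> x = \<one>\<^bsub>SL2 F\<^esub> \<longleftrightarrow> [l ^ x = 1] (mod P)" for x :: nat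
  proof
    assume "A [^]\<^bsub>SL2 F\<^esub> x = \<one>\<^bsub>SL2 F\<^esub>"
    then have "A [^]\<^bsub>SL2 F\<^esub> x = mat2_one F" by (simp add: SL2_def)
    then have Mx: "[M x i j = (if i = j then 1 else 0)] (mod P)" for i j
      using powM[of x i j] by (simp add: one cong_sym)
    \<comment> \<open>This is the \<open>(1, 1)\<close> entry of \<open>W A^x V\<close>, and
      conjugating back gives \<open>l ^ x\<close> there.\<close>
    have "[W $ 1 $ 1 * (M x 1 1 * V $ 1 $ 1 + M x 1 2 * V $ 2 $ 1) + W $ 1 $ 2 * (M x 2 1 * V $ 1 $ 1 + M x 2 2 * V $ 2 $ 1)
        = W $ 1 $ 1 * (1 * V $ 1 $ 1 + 0 * V $ 2 $ 1) + W $ 1 $ 2 * (0 * V $ 1 $ 1 + 1 * V $ 2 $ 1)] (mod P)"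
      using Mx[of 1 1] Mx[of 1 2] Mx[of 2 1] Mx[of 2 2]
      by (intro cong_add cong_mult cong_refl) simp_all
    then have "[W $ 1 $ 1 * (M x 1 1 * V $ 1 $ 1 + M x 1 2 * V $ 2 $ 1) + W $ 1 $ 2 * (M x 2 1 * V $ 1 $ 1 + M x 2 2 * V $ 2 $ 1)
        = 1] (mod P)"
      using WV'[of 1 1] by (simp add: cong_def)
    moreover have "W $ 1 $ 1 * (M x 1 1 * V $ 1 $ 1 + M x 1 2 * V $ 2 $ 1) + W $ 1 $ 2 * (M x 2 1 * V $ 1 $ 1 + M x 2 2 * V $ 2 $ 1)
      = l ^ x * ((W $ 1 $ 1 * V $ 1 $ 1 + W $ 1 $ 2 * V $ 2 $ 1) * (W $ 1 $ 1 * V $ 1 $ 1 + W $ 1 $ 2 * V $ 2 $ 1))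
      + m ^ x * ((W $ 1 $ 1 * V $ 1 $ 2 + W $ 1 $ 2 * V $ 2 $ 2) * (W $ 2 $ 1 * V $ 1 $ 1 + W $ 2 $ 2 * V $ 2 $ 1))"
      by (simp add: M_def algebra_simps)
    moreover have "[\<dots> = l ^ x * (1 * 1) + m ^ x * (0 * 0)] (mod P)"
      using WV'[of 1 1] WV'[of 1 2] WV'[of 2 1] by (intro cong_add cong_mult cong_refl) simp_all
    ultimately show "[l ^ x = 1] (mod P)" by (simp add: cong_def)
  next
    assume l: "[l ^ x = 1] (mod P)"
    then have "[l ^ x * m ^ x = 1 * m ^ x] (mod P)" by (intro cong_mult cong_refl)
    then have m: "[m ^ x = 1] (mod P)" using lm_pow[of x] by (simp add: cong_def)
    have "(A [^]\<^bsub>SL2 F\<^esub> x) $ i $ j = mat2_one F $ i $ j" for i j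
    proof -
      have "[M x i j = V $ i $ 1 * 1 * W $ 1 $ j + V $ i $ 2 * 1 * W $ 2 $ j] (mod P)"
        unfolding M_def by (intro cong_add cong_mult cong_refl l m)
      then have "[(A [^]\<^bsub>SL2 F\<^esub> x) $ i $ j = (if i = j then 1 else 0)] (mod P)"
        using powM[of x i j] VW'[of i j] by (simp add: cong_def)
      then show ?thesis using R.SL2_pow_in_range[OF A, of x i j] P1 unfolding one
        by (intro cong_less_imp_eq_int) auto
    qed
    then show "A [^]\<^bsub>SL2 F\<^esub> x = \<one>\<^bsub>SL2 F\<^esub>" by (simp add: SL2_def vec_eq_iff)
  qed
  let ?ord = "\<lambda>t. t \<ge> 1 \<and> [l ^ t = 1] (mod P)"
  have \<tau>_def': "\<tau> = (LEAST t. ?ord t)" by (simp add: \<tau>_def mult_order_def pow_one_iff)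
  \<comment> \<open>Fermat's little theorem provides an exponent, so that \<open>LEAST\<close> is
    attained.\<close>
  have "?ord (p - 1)"
  proof -
    have "\<not> p dvd nat (l mod P)"
      using not_dvd_l P1 by (simp add: P_def dvd_mod_iff int_dvd_int_iff[symmetric] del: int_dvd_int_iff)
    then have "[nat (l mod P) ^ (p - 1) = 1] (mod p)" by (rule fermat_theorem[OF p])
    then have "[(l mod P) ^ (p - 1) = 1] (mod P)"
      using P1 by (simp add: P_def flip: cong_int_iff)
    then show ?thesis using prime_ge_2_nat[OF p] by (simp add: cong_def power_mod)
  qed
  then have \<tau>: "\<tau> \<ge> 1" "[l ^ \<tau> = 1] (mod P)" and least: "\<And>t. ?ord t \<Longrightarrow> \<tau> \<le> t"
    unfolding \<tau>_def' by (metis (mono_tags, lifting) LeastI, metis (mono_tags, lifting) LeastI, metis (mono_tags, lifting) Least_le)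
  \<comment> \<open>Reducing first gives a function that is additive and periodic on all integers,
    whereas \<psi> is controlled only on the carrier.\<close>
  define e where "e x = \<psi> (x mod P)" for x
  have \<psi>_add: "\<psi> (x \<oplus>\<^bsub>F\<^esub> y) = \<psi> x * \<psi> y" and \<psi>_norm: "norm (\<psi> x) = 1" if "x \<in> carrier F" "y \<in> carrier F" for x y
    using \<psi> that by (auto simp: nontrivial_character_def additive_character_def)
  interpret E: roots_of_unity_character P \<tau> e
  proof
    fix x y
    show "e (x + y) = e x * e y"
      using \<psi>_add[of "x mod P" "y mod P"] P1 by (simp add: e_def FP mod_simps)
    show "norm (e x) = 1" using \<psi>_norm[of "x mod P" 0] P1 by (simp add: e_def FP)
    show "e x = e y" if "[x = y] (mod P)" using that by (simp add: e_def cong_def)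
    obtain z where "z \<in> carrier F" "\<psi> z \<noteq> 1" using \<psi> by (auto simp: nontrivial_character_def)
    then show "\<exists>x. e x \<noteq> 1" by (auto simp: e_def FP intro!: exI[of _ z])
  qed (use primeP \<tau> in auto)
  have inj: "inj_on (\<lambda>x. l ^ x mod P) {1..\<tau>}"
  proof (rule linorder_inj_onI)
    fix x y assume xy: "x < y" "x \<in> {1..\<tau>}" "y \<in> {1..\<tau>}"
    show "l ^ x mod P \<noteq> l ^ y mod P"
    proof
      assume "l ^ x mod P = l ^ y mod P"
      then have "[l ^ x * l ^ (y - x) = l ^ x * 1] (mod P)" using xy by (simp add: cong_def flip: power_add)
      moreover have "coprime (l ^ x) P" using not_dvd_l primeP
        by (metis coprime_commute coprime_power_left_iff prime_imp_coprime)
      ultimately have "[l ^ (y - x) = 1] (mod P)" by (simp only: cong_mult_lcancel)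
      then have "\<tau> \<le> y - x" using xy by (intro least) auto
      then show False using xy by simp
    qed
  qed auto
  have sub: "(\<lambda>x. l ^ x mod P) ` {1..\<tau>} \<subseteq> E.roots"
  proof (intro image_subsetI E.mod_in_roots)
    fix x show "[(l ^ x) ^ \<tau> = 1] (mod P)"
      using cong_pow[OF \<tau>(2), of x] by (simp add: mult.commute flip: power_mult)
  qed
  \<comment> \<open>The powers of \<open>l\<close> are \<open>\<tau>\<close> distinct roots and
    there are at most \<open>\<tau>\<close> roots, so the powers exhaust them.\<close>
  have "card ((\<lambda>x. l ^ x mod P) ` {1..\<tau>}) = \<tau>" using inj by (simp add: card_image)
  then have card: "card E.roots = \<tau>" and img: "(\<lambda>x. l ^ x mod P) ` {1..\<tau>} = E.roots"
    using card_mono[OF _ sub] E.card_roots_le card_subset_eq[OF _ sub] by auto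
  have inv: "[E.root_inv (l ^ x mod P) = m ^ x] (mod P)" for x
  proof -
    have r: "l ^ x mod P \<in> E.roots"
      using cong_pow[OF \<tau>(2), of x] by (intro E.mod_in_roots) (simp add: mult.commute flip: power_mult)
    have "[m ^ x * ((l ^ x mod P) * E.root_inv (l ^ x mod P)) = m ^ x * 1] (mod P)"
      by (intro cong_mult cong_refl E.root_inv r)
    moreover have "[m ^ x * ((l ^ x mod P) * E.root_inv (l ^ x mod P)) = m ^ x * (l ^ x * E.root_inv (l ^ x mod P))] (mod P)"
      by (intro cong_mult cong_refl) simp
    then have "[m ^ x * ((l ^ x mod P) * E.root_inv (l ^ x mod P)) = (l ^ x * m ^ x) * E.root_inv (l ^ x mod P)] (mod P)"
      by (simp only: mult_ac)
    moreover have "[(l ^ x * m ^ x) * E.root_inv (l ^ x mod P) = 1 * E.root_inv (l ^ x mod P)] (mod P)"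
      by (intro cong_mult cong_refl lm_pow)
    ultimately show ?thesis by (simp add: cong_def)
  qed
  \<comment> \<open>Coordinates of \<open>a\<close> and \<open>b\<close> in the eigenbasis; the
    products \<open>aV k * Wb k\<close> become the Kloosterman parameters.\<close>
  define aV where "aV k = a $ 1 * V $ 1 $ k + a $ 2 * V $ 2 $ k" for k :: 2
  define Wb where "Wb k = W $ k $ 1 * b $ 1 + W $ k $ 2 * b $ 2" for k :: 2
  have bilinear: "[dot2 F (row_mult F a (A [^]\<^bsub>SL2 F\<^esub> x)) b = aV 1 * Wb 1 * l ^ x + aV 2 * Wb 2 * m ^ x] (mod P)" for x :: nat
  proof -
    have rm: "[row_mult F a (A [^]\<^bsub>SL2 F\<^esub> x) $ j = a $ 1 * M x 1 j + a $ 2 * M x 2 j] (mod P)" for j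
      unfolding FP by (rule row_mult_residue_cong[OF powM powM, unfolded FP])
    have "[dot2 F (row_mult F a (A [^]\<^bsub>SL2 F\<^esub> x)) b =
        (a $ 1 * M x 1 1 + a $ 2 * M x 2 1) * b $ 1 + (a $ 1 * M x 1 2 + a $ 2 * M x 2 2) * b $ 2] (mod P)"
      unfolding FP by (rule dot2_residue_cong[OF rm rm cong_refl cong_refl, unfolded FP])
    also have "(a $ 1 * M x 1 1 + a $ 2 * M x 2 1) * b $ 1 + (a $ 1 * M x 1 2 + a $ 2 * M x 2 2) * b $ 2 =
      aV 1 * Wb 1 * l ^ x + aV 2 * Wb 2 * m ^ x"
      by (simp add: M_def aV_def Wb_def algebra_simps)
    finally show ?thesis .
  qed
  have "expsum2 F \<psi> a b A = (\<Sum>x = 1..\<tau>. e (aV 1 * Wb 1 * (l ^ x mod P) + aV 2 * Wb 2 * E.root_inv (l ^ x mod P)))"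
    unfolding expsum2_def \<tau>_def[symmetric]
  proof (intro sum.cong refl)
    fix x :: nat
    have "\<psi> (dot2 F (row_mult F a (A [^]\<^bsub>SL2 F\<^esub> x)) b) = e (dot2 F (row_mult F a (A [^]\<^bsub>SL2 F\<^esub> x)) b)"
      by (simp add: e_def dot2_def FP)
    also have "\<dots> = e (aV 1 * Wb 1 * l ^ x + aV 2 * Wb 2 * m ^ x)" by (intro E.e_cong bilinear)
    also have "\<dots> = e (aV 1 * Wb 1 * (l ^ x mod P) + aV 2 * Wb 2 * E.root_inv (l ^ x mod P))"
      by (intro E.e_cong cong_add cong_mult cong_refl cong_sym[OF inv]) simp
    finally show "\<psi> (dot2 F (row_mult F a (A [^]\<^bsub>SL2 F\<^esub> x)) b) =
      e (aV 1 * Wb 1 * (l ^ x mod P) + aV 2 * Wb 2 * E.root_inv (l ^ x mod P))" .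
  qed
  also have "\<dots> = E.kloosterman (aV 1 * Wb 1) (aV 2 * Wb 2)"
    unfolding E.kloosterman_def img[symmetric] sum.reindex[OF inj] by simp
  finally have S: "expsum2 F \<psi> a b A = E.kloosterman (aV 1 * Wb 1) (aV 2 * Wb 2)" .
  have a_eq: "P dvd aV 1 * W $ 1 $ j + aV 2 * W $ 2 $ j - a $ j" for j
  proof -
    have "[a $ 1 * (V $ 1 $ 1 * W $ 1 $ j + V $ 1 $ 2 * W $ 2 $ j) + a $ 2 * (V $ 2 $ 1 * W $ 1 $ j + V $ 2 $ 2 * W $ 2 $ j)
      = a $ 1 * (if 1 = j then 1 else 0) + a $ 2 * (if 2 = j then 1 else 0)] (mod P)"
      by (intro cong_add cong_mult cong_refl VW')
    also have "a $ 1 * (if 1 = j then 1 else 0) + a $ 2 * (if 2 = j then 1 else 0) = a $ j"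
      using exhaust_2[of j] by auto
    finally show ?thesis by (simp add: cong_iff_dvd_diff aV_def algebra_simps)
  qed
  have aA: "P dvd row_mult F a A $ j - (aV 1 * l * W $ 1 $ j + aV 2 * m * W $ 2 $ j)" for j
  proof -
    have "[row_mult F a A $ j = a $ 1 * M 1 1 j + a $ 2 * M 1 2 j] (mod P)"
      unfolding FP by (rule row_mult_residue_cong[OF AM AM])
    then show ?thesis by (simp add: cong_iff_dvd_diff M_def aV_def algebra_simps)
  qed
  have b_eq: "P dvd V $ i $ 1 * Wb 1 + V $ i $ 2 * Wb 2 - b $ i" for i
  proof -
    have "[(V $ i $ 1 * W $ 1 $ 1 + V $ i $ 2 * W $ 2 $ 1) * b $ 1 + (V $ i $ 1 * W $ 1 $ 2 + V $ i $ 2 * W $ 2 $ 2) * b $ 2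
      = (if i = 1 then 1 else 0) * b $ 1 + (if i = 2 then 1 else 0) * b $ 2] (mod P)"
      by (intro cong_add cong_mult cong_refl VW')
    also have "(if i = 1 then 1 else 0) * b $ 1 + (if i = 2 then 1 else 0) * b $ 2 = b $ i"
      using exhaust_2[of i] by auto
    finally show ?thesis by (simp add: cong_iff_dvd_diff Wb_def algebra_simps)
  qed
  have Ab: "P dvd mult_col F A b $ i - (V $ i $ 1 * l * Wb 1 + V $ i $ 2 * m * Wb 2)" for i
  proof -
    have "[mult_col F A b $ i = M 1 i 1 * b $ 1 + M 1 i 2 * b $ 2] (mod P)"
      unfolding FP by (rule mult_col_residue_cong[OF AM AM])
    then show ?thesis by (simp add: cong_iff_dvd_diff M_def Wb_def algebra_simps)
  qed
  note indep = lin_indep2_residue[OF a[unfolded FP] P1, folded FP] lin_indep2_residue[OF b[unfolded FP] P1, folded FP]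
  \<comment> \<open>A vector with a vanishing eigencoordinate is an eigenvector for the other
    eigenvalue, against linear independence. Here \<open>s * x\<close> is the vanishing term and
    \<open>c\<close> the remaining eigenvalue.\<close>
  have combine: "P dvd w - c * u" if "P dvd w - (s * c' * x + t * c * y)" "P dvd s * x + t * y - u" "P dvd s * x" for w c c' u s t x y
  proof -
    have "w - c * u = (w - (s * c' * x + t * c * y)) + c * (s * x + t * y - u) + (c' - c) * (s * x)"
      by (simp add: algebra_simps)
    also have "P dvd \<dots>" by (intro dvd_add dvd_mult that)
    finally show ?thesis .
  qed
  have "\<not> P dvd aV 1"
  proof
    assume "P dvd aV 1"
    then have "P dvd row_mult F a A $ j - m * a $ j" for j
      using combine[OF aA a_eq] by simp
    then show False using indep(1) by blast
  qed
  moreover have "\<not> P dvd aV 2"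
  proof
    assume "P dvd aV 2"
    then have "P dvd row_mult F a A $ j - l * a $ j" for j
      using combine[of "row_mult F a A $ j" "aV 2" m "W $ 2 $ j" "aV 1" l "W $ 1 $ j" "a $ j"] aA[of j] a_eq[of j]
      by (simp add: add.commute)
    then show False using indep(1) by blast
  qed
  moreover have "\<not> P dvd Wb 1"
  proof
    assume "P dvd Wb 1"
    then have "P dvd mult_col F A b $ i - m * b $ i" for i
      using combine[OF Ab b_eq] by simp
    then show False using indep(2) by blast
  qed
  moreover have "\<not> P dvd Wb 2"
  proof
    assume "P dvd Wb 2"
    then have "P dvd mult_col F A b $ i - l * b $ i" for i
      using combine[of "mult_col F A b $ i" "V $ i $ 2" m "Wb 2" "V $ i $ 1" l "Wb 1" "b $ i"] Ab[of i] b_eq[of i]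
      by (simp add: add.commute)
    then show False using indep(2) by blast
  qed
  ultimately have "\<not> P dvd aV 1 * Wb 1" "\<not> P dvd aV 2 * Wb 2" by (auto simp: E.P_dvd_mult_iff)
  from E.norm_kloosterman_le[OF card this] show ?thesis unfolding S by (simp add: P_def)
qed

theorem theorem2p7:
  "\<exists>c>0. \<forall>(p::nat) (\<psi> :: int \<Rightarrow> complex) (a :: int^2) (b :: int^2) (A :: int^2^2).
     let F = residue_ring (int p); \<tau> = mult_order (SL2 F) A in
       prime p \<longrightarrow>
       nontrivial_character F \<psi> \<longrightarrow>
       a \<in> vec2 F \<longrightarrow> b \<in> vec2 F \<longrightarrow>
       A \<in> carrier (SL2 F) \<longrightarrow>
       (\<exists>l\<in>carrier F - {\<zero>\<^bsub>F\<^esub>}. \<exists>m\<in>carrier F - {\<zero>\<^bsub>F\<^esub>}. diagonalisable2 F A l m) \<longrightarrow>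
       lin_indep2 F a (row_mult F a A) \<longrightarrow>
       lin_indep2 F b (mult_col F A b) \<longrightarrow>
       norm (expsum2 F \<psi> a b A) \<le> c *
         min (real \<tau> powr (23/36) * real p powr (1/6))
             (real \<tau> powr (20/27) * real p powr (1/9))"
  unfolding Let_def
proof (rule exI[of _ 2], intro conjI allI impI)
  fix p \<psi> a b A
  let ?F = "residue_ring (int p)"
  assume "\<exists>l\<in>carrier ?F - {\<zero>\<^bsub>?F\<^esub>}. \<exists>m\<in>carrier ?F - {\<zero>\<^bsub>?F\<^esub>}. diagonalisable2 ?F A l m"
  then obtain l m where "diagonalisable2 ?F A l m" by blast
  moreover assume "prime p" "nontrivial_character ?F \<psi>" "A \<in> carrier (SL2 ?F)"
    "lin_indep2 ?F a (row_mult ?F a A)" "lin_indep2 ?F b (mult_col ?F A b)"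
  ultimately show "norm (expsum2 ?F \<psi> a b A) \<le> 2 *
      min (real (mult_order (SL2 ?F) A) powr (23/36) * real p powr (1/6))
          (real (mult_order (SL2 ?F) A) powr (20/27) * real p powr (1/9))"
    by (intro norm_expsum2_le)
qed simp

end
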